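(* Let $d\ge 1$ be an integer and let $\mathbf{X}\subset\mathbb{R}^d$ be a spatial Poisson cluster process with immigrant intensity $\nu\in(0,\infty)$, number of points per cluster $S$ and cluster radius $L$. Assume that the function $\theta\mapsto \mathrm{E}[\mathrm{e}^{\theta S}]$ is essentially smooth, that $0\in\mathcal{D}_S^{\circ}$, and that $$\mathrm{E}[L^d\mathrm{e}^{\theta S}]<\infty\quad\text{for all }\theta\in\mathcal{D}_S^{\circ}.$$ Then the family $\{N_{\mathbf{X}}(b(0,r))/\omega_d(r)\}_{r>0}$ satisfies a large deviation principle on $\mathbb{R}$ (as $r\to\infty$) with speed $\omega_d(r)$ and good rate function $$\Lambda^*(x)=\sup_{\theta\in\mathbb{R}}(\theta x-\Lambda(\theta)),\qquad \Lambda(\theta)=\nu(\mathrm{E}[\mathrm{e}^{\theta S}]-1).$$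
   Context: Spatial Poisson cluster process. The immigrants (cluster centers) are the points $\{X_i\}$ of a homogeneous Poisson process $I\subset\mathbb{R}^d$ with intensity $\nu\in(0,\infty)$. Each immigrant $X_i\in I$ generates a cluster $C_i=C_{X_i}$, a finite point process in $\mathbb{R}^d$ containing $X_i$. Given $I$, the centered clusters $C_{X_i}-X_i=\{Y-X_i:Y\in C_{X_i}\}$ are independent, identically distributed, and independent of $I$. $\mathbf{X}$ is the union of all clusters. $C_0$ denotes the cluster generated by a point at $0$ (i.e. a point process with the common law of the centered clusters); $S$ is the number of points in $C_0$, with standing assumption $\mathrm{E}[S]<\infty$; $L=\sup_{Y\in C_0}\|Y\|$ is the radius of $C_0$ ($\|\cdot\|$ the Euclidean norm). $b(0,r)$ is the Euclidean ball of radius $r$ centered at $0$, $N_{\mathbf{X}}(b(0,r))$ is the number of points of $\mathbf{X}$ in $b(0,r)$, and $\omega_d(r)=r^d\pi^{d/2}/\Gamma(1+d/2)$ is the volume of $b(0,r)$. $\mathcal{D}_S=\{\theta\in\mathbb{R}:\mathrm{E}[\mathrm{e}^{\theta S}]<\infty\}$, with interior $\mathcal{D}_S^{\circ}$; $\Lambda(\theta)=+\infty$ when $\mathrm{E}[\mathrm{e}^{\theta S}]=\infty$. A convex function $\varphi:\mathbb{R}\to(-\infty,\infty]$ is essentially smooth if the interior of $\{\varphi<\infty\}$ is nonempty, $\varphi$ is differentiable on that interior, and $|\varphi'(\theta_n)|\to\infty$ whenever $\theta_n$ is a sequence in the interior converging to a boundary point of it. Large deviation principle (LDP): a family $\{V_\alpha\}_{\alpha\in(0,\infty)}$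 of random variables with values in a topological space $M$ satisfies the LDP with rate function $J$ and speed $v$ if $J:M\to[0,\infty]$ is lower semi-continuous, $v:[0,\infty)\to[0,\infty)$ is measurable and increases to infinity, and for every Borel set $B\subset M$, $$-\inf_{x\in B^\circ}J(x)\le\liminf_{\alpha\to\infty}\frac{1}{v(\alpha)}\log P(V_\alpha\in B)\le\limsup_{\alpha\to\infty}\frac{1}{v(\alpha)}\log P(V_\alpha\in B)\le-\inf_{x\in\overline{B}}J(x).$$ The rate function is good if its level sets $\{x:J(x)\le a\}$, $a\ge 0$, are compact. *)

theory Defs
  imports "HOL-Probability.Probability"
begin

subsection \<open>Finite point processes\<close>

text \<open>
  A finite point process is a random finite multiset, so that points are counted with
  multiplicity; a simple process (a random finite set) is the case of multiplicities at most one.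
  The sigma-algebra is the usual one, generated by the counting maps.
\<close>

definition points_in :: "'a multiset \<Rightarrow> 'a set \<Rightarrow> nat" where
  "points_in C B = size (filter_mset (\<lambda>y. y \<in> B) C)"

definition configurations :: "'a::topological_space multiset measure" where
  "configurations = sigma UNIV {{C. points_in C B = n} | B n. B \<in> sets borel}"

definition cluster_radius :: "'a::real_normed_vector multiset \<Rightarrow> real" where
  "cluster_radius C = (SUP y\<in>set_mset C. norm y)"

subsection \<open>Spatial Poisson cluster processes\<close>

definition homogeneous_poisson_process ::
    "'w measure \<Rightarrow> real \<Rightarrow> ('w \<Rightarrow> 'a::euclidean_space set) \<Rightarrow> bool" where
  "homogeneous_poisson_process M \<nu> I \<longleftrightarrow>
     (AE \<omega> in M. \<forall>B. bounded B \<longrightarrow> finite (I \<omega> \<inter> B)) \<and>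
     (\<forall>B\<in>sets borel. bounded B \<longrightarrow>
        (\<lambda>\<omega>. card (I \<omega> \<inter> B)) \<in> M \<rightarrow>\<^sub>M count_space UNIV \<and>
        (\<forall>n. measure M {\<omega> \<in> space M. card (I \<omega> \<inter> B) = n} =
           (\<nu> * measure lborel B) ^ n / fact n * exp (- (\<nu> * measure lborel B)))) \<and>
     (\<forall>\<B>. finite \<B> \<and> disjoint \<B> \<and> (\<forall>B\<in>\<B>. B \<in> sets borel \<and> bounded B) \<longrightarrow>
        prob_space.indep_vars M (\<lambda>_. count_space UNIV) (\<lambda>B \<omega>. card (I \<omega> \<inter> B)) \<B>)"

definition centered_cluster ::
    "(nat \<Rightarrow> 'w \<Rightarrow> 'a::ab_group_add) \<Rightarrow> (nat \<Rightarrow> 'w \<Rightarrow> 'a multiset) \<Rightarrow> nat \<Rightarrow> 'w \<Rightarrow> 'a multiset" where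
  "centered_cluster X C i \<omega> = image_mset (\<lambda>y. y - X i \<omega>) (C i \<omega>)"

text \<open>
  \<open>X\<close> enumerates the immigrants without repetition (there are almost surely infinitely many),
  \<open>C i\<close> is the cluster generated by \<open>X i\<close>, and \<open>Q\<close> is the law of \<open>C\<^sub>0\<close>, i.e. the common law of the
  centered clusters. Independence of the centered clusters from the immigrants is required for
  the enumerated immigrants: an enumeration that may itself depend on the
  clusters would make independence from the bare set of immigrants too weak.
\<close>

definition poisson_cluster_process ::
    "'w measure \<Rightarrow> real \<Rightarrow> 'a::euclidean_space multiset measure \<Rightarrow>
     (nat \<Rightarrow> 'w \<Rightarrow> 'a) \<Rightarrow> (nat \<Rightarrow> 'w \<Rightarrow> 'a multiset) \<Rightarrow> bool" where
  "poisson_cluster_process M \<nu> Q X C \<longleftrightarrow>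
     prob_space M \<and>
     (\<forall>i. X i \<in> borel_measurable M) \<and>
     (AE \<omega> in M. inj (\<lambda>i. X i \<omega>)) \<and>
     homogeneous_poisson_process M \<nu> (\<lambda>\<omega>. range (\<lambda>i. X i \<omega>)) \<and>
     (AE \<omega> in M. \<forall>i. X i \<omega> \<in># C i \<omega>) \<and>
     (\<forall>i. centered_cluster X C i \<in> M \<rightarrow>\<^sub>M configurations) \<and>
     (\<forall>i. distr M configurations (centered_cluster X C i) = Q) \<and>
     prob_space.indep_vars M (\<lambda>_. configurations) (centered_cluster X C) UNIV \<and>
     prob_space.indep_set M
       (sets (vimage_algebra (space M) (\<lambda>\<omega> i. X i \<omega>) (\<Pi>\<^sub>M i\<in>UNIV. borel)))
       (sets (vimage_algebra (space M) (\<lambda>\<omega> i. centered_cluster X C i \<omega>)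
                (\<Pi>\<^sub>M i\<in>UNIV. configurations)))"

text \<open>
  The number of points in \<open>B\<close> of the union (superposition) of all clusters. For bounded \<open>B\<close> and
  integrable cluster size the series is almost surely finite; \<open>enn2real\<close> returns \<open>0\<close> on the
  exceptional null set.
\<close>

definition cluster_process_count :: "(nat \<Rightarrow> 'w \<Rightarrow> 'a multiset) \<Rightarrow> 'a set \<Rightarrow> 'w \<Rightarrow> real" where
  "cluster_process_count C B \<omega> = enn2real (\<Sum>i. of_nat (points_in (C i \<omega>) B))"

definition ball_volume :: "nat \<Rightarrow> real \<Rightarrow> real" where
  "ball_volume d r = r ^ d * pi powr (real d / 2) / Gamma (1 + real d / 2)"

subsection \<open>Exponential moments of the cluster size\<close>

definition size_mgf :: "'a multiset measure \<Rightarrow> real \<Rightarrow> ereal" where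
  "size_mgf Q \<theta> = enn2ereal (\<integral>\<^sup>+C. ennreal (exp (\<theta> * real (size C))) \<partial>Q)"

definition size_mgf_domain :: "'a multiset measure \<Rightarrow> real set" where
  "size_mgf_domain Q = {\<theta>. size_mgf Q \<theta> < \<infinity>}"

definition cluster_cumulant :: "real \<Rightarrow> 'a multiset measure \<Rightarrow> real \<Rightarrow> ereal" where
  "cluster_cumulant \<nu> Q \<theta> = ereal \<nu> * (size_mgf Q \<theta> - 1)"

definition legendre_transform :: "(real \<Rightarrow> ereal) \<Rightarrow> real \<Rightarrow> ereal" where
  "legendre_transform f x = (SUP \<theta>. ereal (\<theta> * x) - f \<theta>)"

definition essentially_smooth :: "(real \<Rightarrow> ereal) \<Rightarrow> bool" where
  "essentially_smooth f \<longleftrightarrow>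
     (\<forall>x. f x \<noteq> - \<infinity>) \<and>
     (\<forall>x y t. 0 < t \<and> t < 1 \<longrightarrow>
        f ((1 - t) * x + t * y) \<le> ereal (1 - t) * f x + ereal t * f y) \<and>
     (let U = interior {x. f x < \<infinity>}; g = (\<lambda>x. real_of_ereal (f x)) in
        U \<noteq> {} \<and>
        (\<forall>x\<in>U. g differentiable (at x)) \<and>
        (\<forall>\<theta> b. (\<forall>n::nat. \<theta> n \<in> U) \<and> b \<in> frontier U \<and> \<theta> \<longlonglongrightarrow> b \<longrightarrow>
           filterlim (\<lambda>n. \<bar>deriv g (\<theta> n)\<bar>) at_top sequentially))"

subsection \<open>Large deviation principle\<close>

definition log_prob :: "real \<Rightarrow> ereal" where
  "log_prob p = (if p = 0 then - \<infinity> else ereal (ln p))"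

definition is_rate_function :: "('m::topological_space \<Rightarrow> ereal) \<Rightarrow> bool" where
  "is_rate_function J \<longleftrightarrow> (\<forall>x. 0 \<le> J x) \<and> (\<forall>a::ereal. closed {x. J x \<le> a})"

definition is_good :: "('m::topological_space \<Rightarrow> ereal) \<Rightarrow> bool" where
  "is_good J \<longleftrightarrow> (\<forall>a::real. 0 \<le> a \<longrightarrow> compact {x. J x \<le> ereal a})"

definition is_speed :: "(real \<Rightarrow> real) \<Rightarrow> bool" where
  "is_speed v \<longleftrightarrow>
     (\<forall>\<alpha>\<ge>0. 0 \<le> v \<alpha>) \<and> v \<in> borel_measurable (restrict_space borel {0..}) \<and>
     mono_on {0..} v \<and> filterlim v at_top at_top"

definition satisfies_LDP ::
    "'w measure \<Rightarrow> (real \<Rightarrow> 'w \<Rightarrow> 'm::topological_space) \<Rightarrow> (real \<Rightarrow> real) \<Rightarrow> ('m \<Rightarrow> ereal) \<Rightarrow> bool"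
  where
  "satisfies_LDP M V v J \<longleftrightarrow>
     (\<forall>\<alpha>>0. V \<alpha> \<in> borel_measurable M) \<and> is_rate_function J \<and> is_speed v \<and>
     (\<forall>B\<in>sets borel.
        (let rate = (\<lambda>\<alpha>. ereal (1 / v \<alpha>) * log_prob (measure M {\<omega> \<in> space M. V \<alpha> \<omega> \<in> B})) in
           - (INF x\<in>interior B. J x) \<le> Liminf at_top rate \<and>
           Liminf at_top rate \<le> Limsup at_top rate \<and>
           Limsup at_top rate \<le> - (INF x\<in>closure B. J x)))"

end

theory Submission
  imports Defs "HOL-Real_Asymp.Real_Asymp"
begin

text \<open>
  Conditioning on the immigrants and using the Laplace functional of the Poisson process, the
  logarithm of the moment generating function of the number of points in the ball of radius \<open>r\<close> is
  \<open>\<nu> \<integral> E[exp (\<theta> N\<^sub>0(x)) - 1] dx\<close>, where \<open>N\<^sub>0(x)\<close> counts the points that a cluster centred at \<open>x\<close> has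
  in the ball. A cluster of size \<open>S\<close> and radius \<open>L\<close> lies inside the ball if \<open>\<parallel>x\<parallel> < r - L\<close> and
  misses it if \<open>\<parallel>x\<parallel> \<ge> r + L\<close>, so after division by the volume the integral is squeezed between
  \<open>(exp (\<theta> S) - 1) max(0, 1 - L/r)\<^sup>d\<close> and \<open>(exp (\<theta> S) - 1) (1 + L/r)\<^sup>d\<close>, up to sign and in expectation;
  the moment hypothesis lets \<open>r\<close> tend to infinity by dominated convergence. The one-dimensional
  Gaertner-Ellis argument then needs limits only for \<open>\<theta>\<close> in the interior of the domain: Chernoff
  bounds give the upper bound, and tilting gives the lower bound at all derivatives of the
  cumulant. By essential smoothness these exhaust the positive half-line, while \<open>0\<close> is approached
  from the right by exposed points of no larger rate.
\<close>

section \<open>The Gaertner-Ellis argument on the line\<close>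

text \<open>The count in a ball is a series that could be infinite, and exponents of both signs are
  needed, so expectations are first computed in the extended nonnegative reals. For a negative
  exponent the integrand \<open>exp (\<theta> * N) - 1\<close> is negative; factoring out
  \<open>sgn \<theta>\<close> and applying an exponential with factor 1 or -1 afterwards keeps the
  inner integrals nonnegative, so Tonelli and monotone convergence apply directly. Almost sure
  finiteness of the count is recovered at the end from one positive exponent. The moment hypothesis
  is silent at boundary points of the domain, which forces the limit theorem to work with an open
  set of exponents; its rate function is then a supremum over that set and must be compared with the
  full Legendre transform. That S is at least 1 matters twice: the cumulant grows at least
  exponentially when the domain is the whole line, so that every positive slope occurs, and it is
  negative at -1, from which small positive slopes at negative exponents are obtained.\<close>

lemma (in prob_space) integral_exp_pos:
  fixes f :: "'a \<Rightarrow> real"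
  assumes "integrable M (\<lambda>\<omega>. exp (f \<omega>))"
  shows "0 < (\<integral>\<omega>. exp (f \<omega>) \<partial>M)"
proof -
  have "\<not> (AE \<omega> in M. exp (f \<omega>) = 0)"
    using AE_False by simp
  then have "(\<integral>\<omega>. exp (f \<omega>) \<partial>M) \<noteq> 0"
    using integral_nonneg_eq_0_iff_AE[OF assms] by simp
  moreover have "0 \<le> (\<integral>\<omega>. exp (f \<omega>) \<partial>M)" by (intro integral_nonneg_AE) simp
  ultimately show ?thesis by linarith
qed

lemma ereal_le_minus_epsilon:
  fixes y :: ereal
  assumes "\<And>e. 0 < e \<Longrightarrow> ereal (x - e) \<le> y"
  shows "ereal x \<le> y"
proof -
  have "ereal x \<le> y + ereal e" if "0 < e" for e
    using assms[OF that] by (cases y) auto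
  then show ?thesis
    by (rule ereal_le_epsilon2)
qed

lemma log_prob_mono: "0 \<le> p \<Longrightarrow> p \<le> q \<Longrightarrow> log_prob p \<le> log_prob q"
  by (auto simp: log_prob_def)

text \<open>\<open>D\<close> plays the role of the interior of the effective domain: nothing is
  assumed of exponents outside it, where moments may be infinite. \<open>L\<close> is the limiting
  scaled cumulant, not a cluster radius.\<close>

locale scaled_mgf_limit = prob_space M for M :: "'w measure" +
  fixes V :: "real \<Rightarrow> 'w \<Rightarrow> real" and v :: "real \<Rightarrow> real" and D :: "real set" and L :: "real \<Rightarrow> real"
  assumes V_measurable: "\<alpha> > 0 \<Longrightarrow> V \<alpha> \<in> borel_measurable M"
    and speed: "is_speed v"
    and open_D: "open D" and zero_in_D: "0 \<in> D"
    and integrable_exp: "\<theta> \<in> D \<Longrightarrow> \<alpha> > 0 \<Longrightarrow> integrable M (\<lambda>\<omega>. exp (\<theta> * (v \<alpha> * V \<alpha> \<omega>)))"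
    and mgf_limit: "\<theta> \<in> D \<Longrightarrow>
      ((\<lambda>\<alpha>. ln (\<integral>\<omega>. exp (\<theta> * (v \<alpha> * V \<alpha> \<omega>)) \<partial>M) / v \<alpha>) \<longlongrightarrow> L \<theta>) at_top"
begin

definition Z :: "real \<Rightarrow> real \<Rightarrow> real" where
  "Z \<alpha> \<theta> = (\<integral>\<omega>. exp (\<theta> * (v \<alpha> * V \<alpha> \<omega>)) \<partial>M)"

text \<open>The Legendre transform restricted to exponents in \<open>D\<close>. Equality with the
  unrestricted transform is a matter of the application, not of this locale.\<close>

definition J :: "real \<Rightarrow> ereal" where
  "J x = (SUP \<theta>\<in>D. ereal (\<theta> * x - L \<theta>))"

lemma v_at_top: "filterlim v at_top at_top"
  using speed by (simp add: is_speed_def)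

lemma eventually_v: "eventually (\<lambda>\<alpha>. \<alpha> > 0 \<and> v \<alpha> > c) at_top"
  using eventually_conj[OF eventually_gt_at_top[of 0] filterlim_at_top_dense[THEN iffD1, OF v_at_top, rule_format, of c]] .

lemma Z_pos:
  assumes "\<theta> \<in> D" "\<alpha> > 0"
  shows "Z \<alpha> \<theta> > 0"
  unfolding Z_def by (rule integral_exp_pos[OF integrable_exp[OF assms]])

lemma eventually_Z:
  assumes "\<theta> \<in> D" "e > 0"
  shows "eventually (\<lambda>\<alpha>. exp (v \<alpha> * (L \<theta> - e)) \<le> Z \<alpha> \<theta> \<and> Z \<alpha> \<theta> \<le> exp (v \<alpha> * (L \<theta> + e))) at_top"
  using eventually_v[of 0] tendstoD[OF mgf_limit[OF assms(1)] assms(2)]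
proof eventually_elim
  case (elim \<alpha>)
  have "\<bar>ln (Z \<alpha> \<theta>) / v \<alpha> - L \<theta>\<bar> < e"
    using elim by (simp add: Z_def dist_real_def)
  then have "L \<theta> - e < ln (Z \<alpha> \<theta>) / v \<alpha>" "ln (Z \<alpha> \<theta>) / v \<alpha> < L \<theta> + e"
    by auto
  then have "v \<alpha> * (L \<theta> - e) \<le> ln (Z \<alpha> \<theta>)" "ln (Z \<alpha> \<theta>) \<le> v \<alpha> * (L \<theta> + e)"
    using elim by (auto simp: field_simps)
  then show ?case
    using Z_pos[OF assms(1)] elim by (metis exp_le_cancel_iff exp_ln)
qed

text \<open>Exponential Markov inequality under the unnormalised tilt by \<theta>: on the event the
  factor \<open>exp (v \<alpha> * \<eta> * (V \<alpha> \<omega> - x))\<close> is at least 1. The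
  sign of \<eta> selects the upper or the lower tail; \<theta> = 0 leads to the Chernoff bound, and
  small \<eta> to concentration of the tilted law.\<close>

lemma tilted_markov:
  assumes "\<theta> + \<eta> \<in> D" "\<theta> \<in> D" "\<alpha> > 0" "v \<alpha> > 0"
  shows "(\<integral>\<omega>. indicator {\<omega> \<in> space M. \<eta> * x \<le> \<eta> * V \<alpha> \<omega>} \<omega> * exp (\<theta> * (v \<alpha> * V \<alpha> \<omega>)) \<partial>M)
    \<le> exp (- (v \<alpha> * \<eta> * x)) * Z \<alpha> (\<theta> + \<eta>)"
proof -
  note [measurable] = V_measurable[OF assms(3)]
  show ?thesis
    unfolding Z_def integral_mult_right_zero[symmetric]
  proof (rule integral_mono)
    show "integrable M (\<lambda>\<omega>. indicator {\<omega> \<in> space M. \<eta> * x \<le> \<eta> * V \<alpha> \<omega>} \<omega> * exp (\<theta> * (v \<alpha> * V \<alpha> \<omega>)))"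
      by (rule Bochner_Integration.integrable_bound[OF integrable_exp[OF assms(2,3)]])
         (auto simp: indicator_def)
    show "integrable M (\<lambda>\<omega>. exp (- (v \<alpha> * \<eta> * x)) * exp ((\<theta> + \<eta>) * (v \<alpha> * V \<alpha> \<omega>)))"
      using integrable_exp[OF assms(1,3)] by simp
    fix \<omega> assume "\<omega> \<in> space M"
    have "v \<alpha> * \<eta> * x \<le> v \<alpha> * (\<eta> * V \<alpha> \<omega>)" if "\<eta> * x \<le> \<eta> * V \<alpha> \<omega>"
      using mult_left_mono[OF that, of "v \<alpha>"] assms(4) by (simp add: mult.assoc)
    then show "indicator {\<omega> \<in> space M. \<eta> * x \<le> \<eta> * V \<alpha> \<omega>} \<omega> * exp (\<theta> * (v \<alpha> * V \<alpha> \<omega>))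
        \<le> exp (- (v \<alpha> * \<eta> * x)) * exp ((\<theta> + \<eta>) * (v \<alpha> * V \<alpha> \<omega>))"
      by (auto simp: indicator_def exp_add[symmetric] algebra_simps)
  qed
qed

lemma Z_zero [simp]: "Z \<alpha> 0 = 1"
  by (simp add: Z_def prob_space)

lemma L_zero [simp]: "L 0 = 0"
  using mgf_limit[OF zero_in_D] by (simp add: prob_space tendsto_const_iff)

lemma tilted_deviation:
  assumes "\<theta> \<in> D" "\<theta> + \<eta> \<in> D" "c > L (\<theta> + \<eta>) - L \<theta> - \<eta> * x"
  shows "eventually (\<lambda>\<alpha>.
    (\<integral>\<omega>. indicator {\<omega> \<in> space M. \<eta> * x \<le> \<eta> * V \<alpha> \<omega>} \<omega> * exp (\<theta> * (v \<alpha> * V \<alpha> \<omega>)) \<partial>M)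
      \<le> exp (v \<alpha> * c) * Z \<alpha> \<theta>) at_top"
proof -
  \<comment> \<open>Half of the slack: one \<open>e\<close> is spent on the upper estimate of
    \<open>Z \<alpha> (\<theta> + \<eta>)\<close>, the other on the lower estimate of
    \<open>Z \<alpha> \<theta>\<close>.\<close>
  define e where "e = (c - (L (\<theta> + \<eta>) - L \<theta> - \<eta> * x)) / 2"
  have e: "e > 0" "c = 2 * e + (L (\<theta> + \<eta>) - L \<theta> - \<eta> * x)"
    using assms(3) by (auto simp: e_def field_simps)
  show ?thesis
    using eventually_v[of 0] eventually_Z[OF assms(1) e(1)] eventually_Z[OF assms(2) e(1)]
  proof eventually_elim
    case (elim \<alpha>)
    have "(\<integral>\<omega>. indicator {\<omega> \<in> space M. \<eta> * x \<le> \<eta> * V \<alpha> \<omega>} \<omega> * exp (\<theta> * (v \<alpha> * V \<alpha> \<omega>)) \<partial>M)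
      \<le> exp (- (v \<alpha> * \<eta> * x)) * Z \<alpha> (\<theta> + \<eta>)"
      by (rule tilted_markov) (use assms elim in auto)
    also have "\<dots> \<le> exp (- (v \<alpha> * \<eta> * x)) * exp (v \<alpha> * (L (\<theta> + \<eta>) + e))"
      using elim by simp
    also have "\<dots> = exp (v \<alpha> * c) * exp (v \<alpha> * (L \<theta> - e))"
      unfolding exp_add[symmetric] by (subst e(2)) (simp add: algebra_simps)
    also have "\<dots> \<le> exp (v \<alpha> * c) * Z \<alpha> \<theta>"
      using elim by simp
    finally show ?case .
  qed
qed

lemma chernoff:
  assumes "\<theta> \<in> D" "c < \<theta> * x - L \<theta>"
  shows "eventually (\<lambda>\<alpha>. prob {\<omega> \<in> space M. \<theta> * x \<le> \<theta> * V \<alpha> \<omega>} \<le> exp (- (v \<alpha> * c))) at_top"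
proof -
  have 1: "eventually (\<lambda>\<alpha>.
    (\<integral>\<omega>. indicator {\<omega> \<in> space M. \<theta> * x \<le> \<theta> * V \<alpha> \<omega>} \<omega> * exp (0 * (v \<alpha> * V \<alpha> \<omega>)) \<partial>M)
      \<le> exp (v \<alpha> * (- c)) * Z \<alpha> 0) at_top"
    by (rule tilted_deviation) (use assms zero_in_D in auto)
  have "(\<integral>\<omega>. indicator {\<omega> \<in> space M. \<theta> * x \<le> \<theta> * V \<alpha> \<omega>} \<omega> * exp (0 * (v \<alpha> * V \<alpha> \<omega>)) \<partial>M)
     = prob {\<omega> \<in> space M. \<theta> * x \<le> \<theta> * V \<alpha> \<omega>}" if "\<alpha> > 0" for \<alpha>
    by simp (metis (mono_tags) Int_absorb2 mem_Collect_eq subsetI)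
  note 2 = this
  show ?thesis
    using 1 eventually_gt_at_top[of 0]
  proof eventually_elim
    case (elim \<alpha>)
    then show ?case by (simp only: 2 Z_zero) simp
  qed
qed

section \<open>Goodness of the rate function\<close>

lemma J_nonneg: "0 \<le> J x"
  unfolding J_def by (rule SUP_upper2[OF zero_in_D]) simp

lemma closed_J_level: "closed {x. J x \<le> a}"
proof -
  have "{x. J x \<le> a} = (\<Inter>\<theta>\<in>D. {x. ereal (\<theta> * x - L \<theta>) \<le> a})"
    by (auto simp: J_def SUP_le_iff)
  moreover have "closed {x. ereal (\<theta> * x - L \<theta>) \<le> a}" for \<theta>
    by (intro closed_Collect_le continuous_intros)
  ultimately show ?thesis by auto
qed

lemma rate_function_J: "is_rate_function J"
  by (simp add: is_rate_function_def J_nonneg closed_J_level)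

lemma good_J: "is_good J"
  unfolding is_good_def
proof (intro allI impI)
  fix a :: real
  obtain e where e: "e > 0" "ball 0 e \<subseteq> D"
    using open_D zero_in_D by (auto simp: open_contains_ball)
  \<comment> \<open>Since 0 is interior, \<open>J\<close> dominates affine functions of slopes
    \<eta> and -\<eta>, and these bound a level set from both sides.\<close>
  define \<eta> where "\<eta> = e / 2"
  have \<eta>: "\<eta> > 0" "\<eta> \<in> D" "- \<eta> \<in> D"
    using e by (auto simp: \<eta>_def subset_iff dist_real_def)
  have "bounded {x. J x \<le> ereal a}"
  proof (rule bounded_subset[OF bounded_closed_interval], rule subsetI)
    fix x assume "x \<in> {x. J x \<le> ereal a}"
    then have *: "\<theta> * x - L \<theta> \<le> a" if "\<theta> \<in> D" for \<theta>
      using that by (simp add: J_def SUP_le_iff)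
    show "x \<in> {- (a + L (- \<eta>)) / \<eta> .. (a + L \<eta>) / \<eta>}"
      using *[OF \<eta>(2)] *[OF \<eta>(3)] \<eta>(1) by (auto simp: field_simps)
  qed
  then show "compact {x. J x \<le> ereal a}"
    using closed_J_level by (simp add: compact_eq_bounded_closed)
qed

section \<open>Upper and lower bounds for Borel sets\<close>

abbreviation log_rate :: "real set \<Rightarrow> real \<Rightarrow> ereal" where
  "log_rate B \<alpha> \<equiv> ereal (1 / v \<alpha>) * log_prob (prob {\<omega> \<in> space M. V \<alpha> \<omega> \<in> B})"

text \<open>The factor \<open>s\<close> selects the half-line to the right or left of
  \<open>m\<close>. One exponent suffices: choose it to beat \<open>c\<close> at the point of
  \<open>F\<close> nearest to \<open>m\<close> on that side. It must point away from
  \<open>m\<close>, so its half-line event covers the rest of \<open>F\<close> on that side.\<close>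

lemma upper_bound_half:
  assumes F: "closed F" and "s = 1 \<or> s = -1" and mean: "\<And>\<theta>. \<theta> \<in> D \<Longrightarrow> \<theta> * m \<le> L \<theta>"
    and c: "0 \<le> c" "\<And>x. x \<in> F \<Longrightarrow> ereal c < J x"
  shows "eventually (\<lambda>\<alpha>. prob {\<omega> \<in> space M. V \<alpha> \<omega> \<in> F \<and> s * m \<le> s * V \<alpha> \<omega>} \<le> exp (- (v \<alpha> * c))) at_top"
proof (cases "F \<inter> {x. s * m \<le> s * x} = {}")
  case True
  then have "{\<omega> \<in> space M. V \<alpha> \<omega> \<in> F \<and> s * m \<le> s * V \<alpha> \<omega>} = {}" for \<alpha>
    by auto
  then show ?thesis by (simp only: measure_empty) simp
next
  case False
  have s: "s * s = 1" using assms(2) by auto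
  let ?H = "(\<lambda>x. s * x) ` (F \<inter> {x. s * m \<le> s * x})"
  have "closed (F \<inter> {x. s * m \<le> s * x})"
    using F by (intro closed_Int closed_Collect_le continuous_intros) auto
  then have cl: "closed ?H"
    using assms(2) by (auto intro: closed_negations)
  have bdd: "bdd_below ?H" by (rule bdd_belowI[of _ "s * m"]) auto
  have "Inf ?H \<in> ?H" by (rule closed_contains_Inf[OF _ bdd cl]) (use False in auto)
  then obtain b where b: "b \<in> F" "s * m \<le> s * b" "Inf ?H = s * b"
    by auto
  have least: "s * b \<le> s * x" if "x \<in> F" "s * m \<le> s * x" for x
    unfolding b(3)[symmetric] by (rule cInf_lower[OF _ bdd]) (use that in auto)
  obtain \<theta> where \<theta>: "\<theta> \<in> D" "c < \<theta> * b - L \<theta>"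
    using c(2)[OF b(1)] by (auto simp: J_def less_SUP_iff)
  \<comment> \<open>The line of slope \<open>m\<close> through the origin lies below
    \<open>L\<close> on \<open>D\<close>, so a value \<open>\<theta> * b - L \<theta>\<close> above
    c \<ge> 0 forces \<theta> to point from \<open>m\<close> towards \<open>b\<close>.\<close>
  have "\<theta> * (b - m) > 0"
    using mean[OF \<theta>(1)] \<theta>(2) c(1) by (simp add: algebra_simps)
  moreover have "s * (b - m) \<ge> 0" using b(2) by (simp add: algebra_simps)
  ultimately have \<theta>s: "\<theta> = s * \<bar>\<theta>\<bar>"
    using assms(2) by (auto simp: zero_less_mult_iff)
  have "eventually (\<lambda>\<alpha>. prob {\<omega> \<in> space M. \<theta> * b \<le> \<theta> * V \<alpha> \<omega>} \<le> exp (- (v \<alpha> * c))) at_top"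
    by (rule chernoff[OF \<theta>])
  then show ?thesis
    using eventually_gt_at_top[of 0]
  proof eventually_elim
    case (elim \<alpha>)
    note [measurable] = V_measurable[OF elim(2)]
    have "prob {\<omega> \<in> space M. V \<alpha> \<omega> \<in> F \<and> s * m \<le> s * V \<alpha> \<omega>} \<le> prob {\<omega> \<in> space M. \<theta> * b \<le> \<theta> * V \<alpha> \<omega>}"
    proof (rule finite_measure_mono)
      show "{\<omega> \<in> space M. V \<alpha> \<omega> \<in> F \<and> s * m \<le> s * V \<alpha> \<omega>} \<subseteq> {\<omega> \<in> space M. \<theta> * b \<le> \<theta> * V \<alpha> \<omega>}"
      proof safe
        fix \<omega> assume "V \<alpha> \<omega> \<in> F" "s * m \<le> s * V \<alpha> \<omega>"
        then have "\<bar>\<theta>\<bar> * (s * b) \<le> \<bar>\<theta>\<bar> * (s * V \<alpha> \<omega>)"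
          by (intro mult_left_mono[OF least]) auto
        then show "\<theta> * b \<le> \<theta> * V \<alpha> \<omega>" by (subst (1 2) \<theta>s) (simp add: ac_simps)
      qed
    qed measurable
    then show ?case using elim by simp
  qed
qed

text \<open>\<open>m\<close> stands for the limiting mean. Cutting the closure at \<open>m\<close>
  leaves two pieces with the same exponential bound; adding them costs
  \<open>ln 2 / v \<alpha>\<close>, which vanishes.\<close>

lemma upper_bound:
  assumes B: "B \<in> sets borel" and mean: "\<And>\<theta>. \<theta> \<in> D \<Longrightarrow> \<theta> * m \<le> L \<theta>"
  shows "Limsup at_top (log_rate B) \<le> - (INF x\<in>closure B. J x)"
proof (cases "(INF x\<in>closure B. J x) \<le> 0")
  case True
  have "eventually (\<lambda>\<alpha>. log_rate B \<alpha> \<le> 0) at_top"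
    using eventually_v[of 0]
  proof eventually_elim
    case (elim \<alpha>)
    have "log_prob (prob {\<omega> \<in> space M. V \<alpha> \<omega> \<in> B}) \<le> log_prob 1"
      by (rule log_prob_mono) auto
    then have "log_rate B \<alpha> \<le> ereal (1 / v \<alpha>) * log_prob 1"
      using elim by (intro ereal_mult_left_mono) auto
    also have "ereal (1 / v \<alpha>) * log_prob 1 = 0"
      by (simp add: log_prob_def flip: zero_ereal_def)
    finally show ?case .
  qed
  then have "Limsup at_top (log_rate B) \<le> 0"
    by (rule Limsup_bounded)
  also have "\<dots> \<le> - (INF x\<in>closure B. J x)" using True ereal_0_le_uminus_iff by blast
  finally show ?thesis .
next
  case False
  \<comment> \<open>Working with real levels \<open>c\<close> strictly below the infimum avoids
    arithmetic with an infinite infimum.\<close>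
  have "Limsup at_top (log_rate B) \<le> ereal (- c)"
    if c: "0 \<le> c" "ereal c < (INF x\<in>closure B. J x)" for c
  proof -
    have cJ: "ereal c < J x" if "x \<in> closure B" for x
      using c(2) INF_lower[OF that, of J] by (rule less_le_trans)
    have half: "eventually (\<lambda>\<alpha>. prob {\<omega> \<in> space M. V \<alpha> \<omega> \<in> closure B \<and> s * m \<le> s * V \<alpha> \<omega>} \<le> exp (- (v \<alpha> * c))) at_top"
      if "s = 1 \<or> s = -1" for s
      by (rule upper_bound_half[OF closed_closure that mean c(1) cJ])
    have "eventually (\<lambda>\<alpha>. log_rate B \<alpha> \<le> ereal (ln 2 / v \<alpha> - c)) at_top"
      using eventually_v[of 0] half[of 1, simplified] half[of "-1", simplified]
    proof eventually_elim
      case (elim \<alpha>)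
      then have "\<alpha> > 0" by simp
      note [measurable] = V_measurable[OF \<open>\<alpha> > 0\<close>] borel_closed[OF closed_closure[of B]]
      let ?p = "prob {\<omega> \<in> space M. V \<alpha> \<omega> \<in> B}"
      have "?p \<le> prob ({\<omega> \<in> space M. V \<alpha> \<omega> \<in> closure B \<and> m \<le> V \<alpha> \<omega>} \<union>
          {\<omega> \<in> space M. V \<alpha> \<omega> \<in> closure B \<and> V \<alpha> \<omega> \<le> m})"
        by (rule finite_measure_mono, use closure_subset[of B] in \<open>auto simp: not_le\<close>) measurable
      also have "\<dots> \<le> prob {\<omega> \<in> space M. V \<alpha> \<omega> \<in> closure B \<and> m \<le> V \<alpha> \<omega>} +
          prob {\<omega> \<in> space M. V \<alpha> \<omega> \<in> closure B \<and> V \<alpha> \<omega> \<le> m}"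
        by (rule measure_Un_le) measurable
      also have "\<dots> \<le> 2 * exp (- (v \<alpha> * c))" using elim by simp
      finally have "log_prob ?p \<le> log_prob (2 * exp (- (v \<alpha> * c)))"
        by (rule log_prob_mono[rotated]) simp
      also have "\<dots> = ereal (ln 2 - v \<alpha> * c)"
        by (simp add: log_prob_def ln_mult)
      finally have "log_rate B \<alpha> \<le> ereal (1 / v \<alpha>) * ereal (ln 2 - v \<alpha> * c)"
        using elim by (intro ereal_mult_left_mono) auto
      also have "\<dots> = ereal (ln 2 / v \<alpha> - c)"
        using elim by (simp add: field_simps)
      finally show ?case .
    qed
    then have "Limsup at_top (log_rate B) \<le> Limsup at_top (\<lambda>\<alpha>. ereal (ln 2 / v \<alpha> - c))"
      by (rule Limsup_mono)
    also have "\<dots> = ereal (0 - c)"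
      by (intro lim_imp_Limsup tendsto_intros real_tendsto_divide_at_top[OF tendsto_const v_at_top]) simp_all
    finally show ?thesis by simp
  qed
  note * = this
  show ?thesis
  proof (rule dense_ge)
    fix z assume "- (INF x\<in>closure B. J x) < z"
    then have z: "- z < (INF x\<in>closure B. J x)"
      using ereal_uminus_less_reorder by blast
    moreover have "0 < (INF x\<in>closure B. J x)" using False by (simp only: not_le)
    ultimately have "max 0 (- z) < (INF x\<in>closure B. J x)" by (rule max_less_iff_conj[THEN iffD2, OF conjI, rotated])
    then obtain c where c: "max 0 (- z) < ereal c" "ereal c < (INF x\<in>closure B. J x)"
      using ereal_dense2 by blast
    have "Limsup at_top (log_rate B) \<le> ereal (- c)"
      using c by (intro *) auto
    also have "\<dots> \<le> z"
      using c(1) by (cases z) auto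
    finally show "Limsup at_top (log_rate B) \<le> z" .
  qed
qed

text \<open>The tilted law has limiting cumulant \<open>L (\<theta> + \<eta>) - L \<theta>\<close>,
  which by differentiability is \<open>\<eta> * y\<close> up to
  \<open>\<bar>\<eta>\<bar> * \<delta> / 2\<close> for small \<eta>; a deviation by \<delta> from
  \<open>y\<close> is then exponentially unlikely. The constant 1/4 leaves at least half of the mass
  near \<open>y\<close> once both tails are removed.\<close>

lemma tilted_concentration:
  assumes \<theta>: "\<theta> \<in> D" and deriv: "(L has_real_derivative y) (at \<theta>)"
    and \<delta>: "\<delta> > 0" and s: "s = 1 \<or> s = -1"
  shows "eventually (\<lambda>\<alpha>. (\<integral>\<omega>. indicator {\<omega> \<in> space M. s * y + \<delta> \<le> s * V \<alpha> \<omega>} \<omega> * exp (\<theta> * (v \<alpha> * V \<alpha> \<omega>)) \<partial>M)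
      \<le> Z \<alpha> \<theta> / 4) at_top"
proof -
  have "((\<lambda>h. (L (\<theta> + h) - L \<theta>) / h) \<longlongrightarrow> y) (at 0)"
    using deriv by (simp add: DERIV_def)
  then have "eventually (\<lambda>h. dist ((L (\<theta> + h) - L \<theta>) / h) y < \<delta> / 2) (at 0)"
    by (rule tendstoD) (use \<delta> in simp)
  then obtain e where e: "e > 0" "\<And>h. h \<noteq> 0 \<Longrightarrow> \<bar>h\<bar> < e \<Longrightarrow> \<bar>(L (\<theta> + h) - L \<theta>) / h - y\<bar> < \<delta> / 2"
    unfolding eventually_at dist_real_def by auto
  obtain e' where e': "e' > 0" "ball \<theta> e' \<subseteq> D"
    using open_D \<theta> by (auto simp: open_contains_ball)
  \<comment> \<open>The sign aims at the chosen tail; the size keeps \<eta> within the range of the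
    difference-quotient estimate and \<theta> + \<eta> inside \<open>D\<close>.\<close>
  define \<eta> where "\<eta> = s * (min e e' / 2)"
  have \<eta>: "\<eta> \<noteq> 0" "\<bar>\<eta>\<bar> < e" "\<theta> + \<eta> \<in> D" "\<eta> = s * \<bar>\<eta>\<bar>" "s * \<eta> = \<bar>\<eta>\<bar>"
    using e(1) e' s by (auto simp: \<eta>_def subset_iff dist_real_def)
  define x where "x = y + s * \<delta>"
  have ss: "s * s = 1" using s by auto
  have "\<bar>L (\<theta> + \<eta>) - L \<theta> - \<eta> * y\<bar> = \<bar>\<eta>\<bar> * \<bar>(L (\<theta> + \<eta>) - L \<theta>) / \<eta> - y\<bar>"
    using \<eta>(1) by (simp add: abs_mult[symmetric] field_simps)
  also have "\<dots> \<le> \<bar>\<eta>\<bar> * (\<delta> / 2)"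
    using e(2)[OF \<eta>(1,2)] by (intro mult_left_mono) auto
  finally have "L (\<theta> + \<eta>) - L \<theta> - \<eta> * y \<le> \<bar>\<eta>\<bar> * (\<delta> / 2)"
    by (rule order_trans[OF abs_ge_self])
  moreover have "\<eta> * x = \<eta> * y + \<bar>\<eta>\<bar> * \<delta>"
    using \<eta>(5) by (simp add: x_def algebra_simps)
  ultimately have "L (\<theta> + \<eta>) - L \<theta> - \<eta> * x \<le> - (\<bar>\<eta>\<bar> * \<delta> / 2)"
    by simp
  moreover have "\<bar>\<eta>\<bar> * \<delta> > 0" using \<eta>(1) \<delta> by simp
  \<comment> \<open>The exponent is at most \<open>- (\<bar>\<eta>\<bar> * \<delta> / 2)\<close>;
    giving up half of it provides the strict inequality that \<open>tilted_deviation\<close> asks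
    for.\<close>
  ultimately have 1: "eventually (\<lambda>\<alpha>.
    (\<integral>\<omega>. indicator {\<omega> \<in> space M. \<eta> * x \<le> \<eta> * V \<alpha> \<omega>} \<omega> * exp (\<theta> * (v \<alpha> * V \<alpha> \<omega>)) \<partial>M)
      \<le> exp (v \<alpha> * - (\<bar>\<eta>\<bar> * \<delta> / 4)) * Z \<alpha> \<theta>) at_top"
    by (intro tilted_deviation[OF \<theta> \<eta>(3)]) linarith
  have 2: "{\<omega> \<in> space M. \<eta> * x \<le> \<eta> * V \<alpha> \<omega>} = {\<omega> \<in> space M. s * y + \<delta> \<le> s * V \<alpha> \<omega>}" for \<alpha>
  proof -
    have "\<eta> * x \<le> \<eta> * w \<longleftrightarrow> s * y + \<delta> \<le> s * w" for w
    proof -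
      have "\<eta> * x \<le> \<eta> * w \<longleftrightarrow> \<bar>\<eta>\<bar> * (s * x) \<le> \<bar>\<eta>\<bar> * (s * w)"
        by (subst (1 2) \<eta>(4)) (simp add: ac_simps)
      also have "\<dots> \<longleftrightarrow> s * x \<le> s * w" using \<eta>(1) by simp
      also have "s * x = s * y + s * s * \<delta>" by (simp add: x_def algebra_simps)
      finally show ?thesis by (simp add: ss)
    qed
    then show ?thesis by simp
  qed
  have 3: "eventually (\<lambda>\<alpha>. exp (v \<alpha> * - (\<bar>\<eta>\<bar> * \<delta> / 4)) \<le> 1 / 4) at_top"
    using eventually_v[of "ln 4 / (\<bar>\<eta>\<bar> * \<delta> / 4)"]
  proof eventually_elim
    case (elim \<alpha>)
    then have "ln 4 \<le> v \<alpha> * (\<bar>\<eta>\<bar> * \<delta> / 4)"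
      using \<open>\<bar>\<eta>\<bar> * \<delta> > 0\<close> by (simp add: field_simps)
    then have "exp (v \<alpha> * - (\<bar>\<eta>\<bar> * \<delta> / 4)) \<le> exp (- ln (4::real))" by simp
    also have "\<dots> = 1 / 4" by (simp add: exp_minus)
    finally show ?case .
  qed
  show ?thesis
    using 1 3 eventually_gt_at_top[of 0]
  proof eventually_elim
    case (elim \<alpha>)
    then show ?case
      using mult_right_mono[OF elim(2), of "Z \<alpha> \<theta>"] less_imp_le[OF Z_pos[OF \<theta> elim(3)]]
      unfolding 2 by linarith
  qed
qed

text \<open>A change of measure without forming the tilted measure:
  \<open>Z \<alpha> \<theta>\<close> splits into the part near \<open>y\<close> and two tails. The
  tails take at most half, and near \<open>y\<close> the weight exceeds
  \<open>exp (v \<alpha> * \<theta> * y)\<close> by at most the factor responsible for the loss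
  \<open>\<bar>\<theta>\<bar> * \<delta>\<close>.\<close>

lemma lower_bound_exposed:
  assumes \<theta>: "\<theta> \<in> D" and deriv: "(L has_real_derivative y) (at \<theta>)"
    and B: "B \<in> sets borel" and \<delta>: "\<delta> > 0" "ball y \<delta> \<subseteq> B"
  shows "ereal (- (\<theta> * y - L \<theta>) - \<bar>\<theta>\<bar> * \<delta>) \<le> Liminf at_top (log_rate B)"
proof -
  have *: "ereal (- (\<theta> * y - L \<theta>) - \<bar>\<theta>\<bar> * \<delta> - e) \<le> Liminf at_top (log_rate B)" if e: "e > 0" for e
  proof -
    let ?k = "- (\<theta> * y - L \<theta>) - \<bar>\<theta>\<bar> * \<delta> - e"
    have "eventually (\<lambda>\<alpha>. ereal (?k - ln 2 / v \<alpha>) \<le> log_rate B \<alpha>) at_top"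
      using eventually_v[of 0] eventually_Z[OF \<theta> e]
        tilted_concentration[OF \<theta> deriv \<delta>(1), of 1, simplified]
        tilted_concentration[OF \<theta> deriv \<delta>(1), of "-1", simplified]
    proof eventually_elim
      case (elim \<alpha>)
      then have \<alpha>: "\<alpha> > 0" by simp
      note [measurable] = V_measurable[OF \<alpha>]
      define g where "g \<omega> = exp (\<theta> * (v \<alpha> * V \<alpha> \<omega>))" for \<omega>
      let ?U = "{\<omega> \<in> space M. y + \<delta> \<le> V \<alpha> \<omega>}" and ?W = "{\<omega> \<in> space M. - y + \<delta> \<le> - V \<alpha> \<omega>}"
      let ?A = "{\<omega> \<in> space M. \<bar>V \<alpha> \<omega> - y\<bar> < \<delta>}"
      let ?K = "exp (v \<alpha> * (\<theta> * y + \<bar>\<theta>\<bar> * \<delta>))"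
      have [measurable]: "g \<in> borel_measurable M" unfolding g_def by measurable
      have g: "integrable M g" unfolding g_def by (rule integrable_exp[OF \<theta> \<alpha>])
      have gi: "integrable M (\<lambda>\<omega>. indicator E \<omega> * g \<omega>)" if "E \<in> sets M" for E
        using integrable_mult_indicator[OF that g] by simp
      have "Z \<alpha> \<theta> \<le> (\<integral>\<omega>. indicator ?A \<omega> * ?K + (indicator ?U \<omega> * g \<omega> + indicator ?W \<omega> * g \<omega>) \<partial>M)"
        unfolding Z_def
      proof (rule integral_mono)
        show "integrable M (\<lambda>\<omega>. exp (\<theta> * (v \<alpha> * V \<alpha> \<omega>)))" by (rule integrable_exp[OF \<theta> \<alpha>])
        show "integrable M (\<lambda>\<omega>. indicator ?A \<omega> * ?K + (indicator ?U \<omega> * g \<omega> + indicator ?W \<omega> * g \<omega>))"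
          by (intro Bochner_Integration.integrable_add gi integrable_mult_left) (auto simp: emeasure_eq_measure)
        fix \<omega> assume \<omega>: "\<omega> \<in> space M"
        have "\<theta> * (v \<alpha> * V \<alpha> \<omega>) \<le> v \<alpha> * (\<theta> * y + \<bar>\<theta>\<bar> * \<delta>)" if "\<bar>V \<alpha> \<omega> - y\<bar> < \<delta>"
        proof -
          have "\<theta> * (V \<alpha> \<omega> - y) \<le> \<bar>\<theta>\<bar> * \<bar>V \<alpha> \<omega> - y\<bar>" by (metis abs_ge_self abs_mult)
          also have "\<dots> \<le> \<bar>\<theta>\<bar> * \<delta>" using that by (intro mult_left_mono) auto
          finally have "\<theta> * V \<alpha> \<omega> \<le> \<theta> * y + \<bar>\<theta>\<bar> * \<delta>" by (simp add: algebra_simps)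
          then have "v \<alpha> * (\<theta> * V \<alpha> \<omega>) \<le> v \<alpha> * (\<theta> * y + \<bar>\<theta>\<bar> * \<delta>)"
            using elim by (intro mult_left_mono) auto
          then show ?thesis by (simp add: ac_simps)
        qed
        then show "exp (\<theta> * (v \<alpha> * V \<alpha> \<omega>)) \<le> indicator ?A \<omega> * ?K + (indicator ?U \<omega> * g \<omega> + indicator ?W \<omega> * g \<omega>)"
          using \<omega> \<delta>(1) by (auto simp: indicator_def g_def)
      qed
      also have "\<dots> = prob ?A * ?K + ((\<integral>\<omega>. indicator ?U \<omega> * g \<omega> \<partial>M) + (\<integral>\<omega>. indicator ?W \<omega> * g \<omega> \<partial>M))"
      proof -
        have "?A \<in> sets M" "?U \<in> sets M" "?W \<in> sets M" by measurable
        moreover have "?A \<inter> space M = ?A" by blast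
        moreover have "integrable M (\<lambda>\<omega>. indicator ?A \<omega> * ?K)"
          using calculation(1) by (intro integrable_mult_left) (simp add: emeasure_eq_measure)
        ultimately show ?thesis
          by (simp only: Bochner_Integration.integral_add gi Bochner_Integration.integrable_add
              integral_mult_left_zero Bochner_Integration.integral_indicator)
      qed
      also have "\<dots> \<le> prob ?A * ?K + Z \<alpha> \<theta> / 2"
        using elim(3,4) unfolding g_def by simp
      finally have "Z \<alpha> \<theta> / 2 \<le> prob ?A * ?K" by simp
      moreover have "exp (v \<alpha> * (L \<theta> - e)) / 2 \<le> Z \<alpha> \<theta> / 2" using elim by simp
      ultimately have "exp (v \<alpha> * (L \<theta> - e)) / 2 \<le> prob ?A * ?K" by simp
      then have "exp (v \<alpha> * (L \<theta> - e)) / 2 / ?K \<le> prob ?A"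
        by (simp add: pos_divide_le_eq)
      also have "exp (v \<alpha> * (L \<theta> - e)) / 2 / ?K = exp (v \<alpha> * ?k - ln 2)"
        proof -
          have "exp (v \<alpha> * ?k - ln 2) = exp (v \<alpha> * (L \<theta> - e) - ln 2 - v \<alpha> * (\<theta> * y + \<bar>\<theta>\<bar> * \<delta>))"
            by (simp add: algebra_simps)
          then show ?thesis by (simp add: exp_diff)
        qed
      also have "prob ?A \<le> prob {\<omega> \<in> space M. V \<alpha> \<omega> \<in> B}"
        using \<delta>(2) B by (intro finite_measure_mono) (auto simp: subset_iff dist_real_def abs_minus_commute)
      finally have *: "exp (v \<alpha> * ?k - ln 2) \<le> prob {\<omega> \<in> space M. V \<alpha> \<omega> \<in> B}" .
      have "ereal (?k - ln 2 / v \<alpha>) = ereal (1 / v \<alpha>) * log_prob (exp (v \<alpha> * ?k - ln 2))"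
        using elim by (simp add: log_prob_def field_simps)
      also have "\<dots> \<le> log_rate B \<alpha>"
        using elim * by (intro ereal_mult_left_mono log_prob_mono) auto
      finally show ?case .
    qed
    then have "Liminf at_top (\<lambda>\<alpha>. ereal (?k - ln 2 / v \<alpha>)) \<le> Liminf at_top (log_rate B)"
      by (rule Liminf_mono)
    moreover have "Liminf at_top (\<lambda>\<alpha>. ereal (?k - ln 2 / v \<alpha>)) = ereal (?k - 0)"
      by (intro lim_imp_Liminf tendsto_intros real_tendsto_divide_at_top[OF tendsto_const v_at_top]) simp_all
    ultimately show ?thesis by simp
  qed
  then show ?thesis by (rule ereal_le_minus_epsilon)
qed

text \<open>A point of finite rate need not be a derivative of \<open>L\<close>; as the interior is
  open, it is enough to find derivatives arbitrarily near it whose cost does not exceed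
  \<open>J x\<close>. Points of infinite rate impose nothing.\<close>

lemma lower_bound:
  assumes B: "B \<in> sets borel"
    and exposed: "\<And>x e. J x < \<infinity> \<Longrightarrow> e > 0 \<Longrightarrow>
      \<exists>\<theta>\<in>D. \<exists>y. (L has_real_derivative y) (at \<theta>) \<and> \<bar>y - x\<bar> < e \<and> ereal (\<theta> * y - L \<theta>) \<le> J x"
  shows "- (INF x\<in>interior B. J x) \<le> Liminf at_top (log_rate B)"
proof -
  have "- J x \<le> Liminf at_top (log_rate B)" if x: "x \<in> interior B" for x
  proof (cases "J x < \<infinity>")
    case True
    obtain e where e: "e > 0" "ball x e \<subseteq> B"
      using x by (meson mem_interior)
    obtain \<theta> y where *: "\<theta> \<in> D" "(L has_real_derivative y) (at \<theta>)" "\<bar>y - x\<bar> < e"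
        "ereal (\<theta> * y - L \<theta>) \<le> J x"
      using exposed[OF True e(1)] by blast
    have "ereal (- (\<theta> * y - L \<theta>) - k) \<le> Liminf at_top (log_rate B)" if "k > 0" for k
    proof -
      \<comment> \<open>The first bound keeps the ball around \<open>y\<close> within the ball
        around \<open>x\<close>; the second makes the loss
        \<open>\<bar>\<theta>\<bar> * \<delta>\<close> at most \<open>k\<close>, with +1 guarding
        against \<theta> = 0.\<close>
      define \<delta> where "\<delta> = min (e - \<bar>y - x\<bar>) (k / (\<bar>\<theta>\<bar> + 1))"
      have \<delta>: "\<delta> > 0" using *(3) that by (simp add: \<delta>_def)
      have "ball y \<delta> \<subseteq> B"
        using e(2) by (auto simp: \<delta>_def subset_iff dist_real_def)
      then have "ereal (- (\<theta> * y - L \<theta>) - \<bar>\<theta>\<bar> * \<delta>) \<le> Liminf at_top (log_rate B)"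
        by (rule lower_bound_exposed[OF *(1,2) B \<delta>])
      moreover have "\<bar>\<theta>\<bar> * \<delta> \<le> k"
      proof -
        have "\<bar>\<theta>\<bar> * \<delta> \<le> (\<bar>\<theta>\<bar> + 1) * (k / (\<bar>\<theta>\<bar> + 1))"
          using \<delta> by (intro mult_mono) (auto simp: \<delta>_def)
        also have "\<dots> = k" by simp
        finally show ?thesis .
      qed
      then have "ereal (- (\<theta> * y - L \<theta>) - k) \<le> ereal (- (\<theta> * y - L \<theta>) - \<bar>\<theta>\<bar> * \<delta>)"
        by simp
      ultimately show ?thesis
        by (rule order_trans[rotated])
    qed
    then have "ereal (- (\<theta> * y - L \<theta>)) \<le> Liminf at_top (log_rate B)"
      by (rule ereal_le_minus_epsilon)
    moreover have "- J x \<le> - ereal (\<theta> * y - L \<theta>)"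
      using *(4) by (simp only: ereal_minus_le_minus)
    ultimately show ?thesis
      unfolding uminus_ereal.simps by (rule order_trans[rotated])
  next
    case False
    then show ?thesis by simp
  qed
  then have "\<forall>x\<in>interior B. - Liminf at_top (log_rate B) \<le> J x"
    using ereal_uminus_le_reorder by blast
  then have "- Liminf at_top (log_rate B) \<le> (INF x\<in>interior B. J x)"
    by (intro INF_greatest) auto
  then show ?thesis using ereal_uminus_le_reorder by blast
qed

theorem LDP:
  assumes "\<And>\<theta>. \<theta> \<in> D \<Longrightarrow> \<theta> * m \<le> L \<theta>"
    and "\<And>x e. J x < \<infinity> \<Longrightarrow> e > 0 \<Longrightarrow>
      \<exists>\<theta>\<in>D. \<exists>y. (L has_real_derivative y) (at \<theta>) \<and> \<bar>y - x\<bar> < e \<and> ereal (\<theta> * y - L \<theta>) \<le> J x"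
  shows "satisfies_LDP M V v J"
  unfolding satisfies_LDP_def Let_def
  using V_measurable speed rate_function_J upper_bound[OF _ assms(1)] lower_bound[OF _ assms(2)]
  by (auto intro: Liminf_le_Limsup)

end

section \<open>Counting points of configurations\<close>

lemma points_in_UNIV: "points_in C UNIV = size C"
  by (simp add: points_in_def)

lemma points_in_mono: "A \<subseteq> B \<Longrightarrow> points_in C A \<le> points_in C B"
  by (induction C) (auto simp: points_in_def)

lemma points_in_le_size: "points_in C A \<le> size C"
  using points_in_mono[of A UNIV C] by (simp add: points_in_UNIV)

lemma points_in_image_mset: "points_in (image_mset f C) B = points_in C (f -` B)"
  by (simp add: points_in_def filter_mset_image_mset vimage_def)

lemma points_in_eq_size: "set_mset C \<subseteq> B \<Longrightarrow> points_in C B = size C"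
  by (induction C) (auto simp: points_in_def)

lemma points_in_eq_0_iff: "points_in C B = 0 \<longleftrightarrow> (\<forall>y\<in>#C. y \<notin> B)"
  by (induction C) (auto simp: points_in_def)

lemma of_nat_points_in_add_mset:
  "(of_nat (points_in (add_mset y C) A) :: ennreal) = indicator A y + of_nat (points_in C A)"
  by (simp add: points_in_def indicator_def)

lemma suminf_points_in:
  assumes "disjoint_family A"
  shows "(\<Sum>i. of_nat (points_in C (A i)) :: ennreal) = of_nat (points_in C (\<Union>i. A i))"
proof (induction C)
  case empty
  then show ?case by (simp add: points_in_def)
next
  case (add y C)
  then show ?case
    unfolding of_nat_points_in_add_mset
    by (subst suminf_add[symmetric]) (simp_all add: suminf_indicator[OF assms])
qed

lemma sets_configurations:
  "sets (configurations :: 'a::topological_space multiset measure) =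
     sigma_sets UNIV {{C. points_in C B = n} | B n. B \<in> sets borel}"
  unfolding configurations_def by (rule sets_measure_of) auto

lemma space_configurations [simp]: "space configurations = UNIV"
  by (simp add: configurations_def space_measure_of_conv)

lemma measurable_points_in:
  assumes "B \<in> sets borel"
  shows "(\<lambda>C. points_in C B) \<in> configurations \<rightarrow>\<^sub>M count_space UNIV"
proof (rule measurableI)
  fix S :: "nat set"
  have "(\<lambda>C. points_in C B) -` S \<inter> space configurations = (\<Union>n\<in>S. {C. points_in C B = n})"
    by auto
  also have "\<dots> \<in> sets configurations"
    using assms by (intro sets.countable_UN' sets.countable_UN) (auto simp: sets_configurations)
  finally show "(\<lambda>C. points_in C B) -` S \<inter> space configurations \<in> sets configurations" .
qed simp

text \<open>The window in which a centered cluster is counted moves with its immigrant, so joint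
  measurability in shape and position is needed. The induction starts from rectangles; complements
  work because configurations are finite and counts can be subtracted, disjoint unions because
  counting is additive.\<close>

lemma measurable_points_in_section:
  assumes "A \<in> sets (borel \<Otimes>\<^sub>M N)"
  shows "(\<lambda>(C, x). of_nat (points_in C {y. (y, x) \<in> A}) :: ennreal) \<in> borel_measurable (configurations \<Otimes>\<^sub>M N)"
  using Int_stable_pair_measure_generator[of borel N] pair_measure_closed assms
  unfolding sets_pair_measure
proof (induction rule: sigma_sets_induct_disjoint)
  case (basic A)
  then obtain a b where A: "A = a \<times> b" "a \<in> sets borel" "b \<in> sets N" by auto
  note [measurable] = measurable_points_in[OF A(2)] A(3)
  have "(\<lambda>(C, x). of_nat (points_in C {y. (y, x) \<in> A}) :: ennreal) =
      (\<lambda>(C, x). of_nat (points_in C a) * indicator b x)"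
    by (auto simp: A(1) fun_eq_iff indicator_def points_in_def)
  then show ?case by simp
next
  case empty
  then show ?case by (simp add: points_in_def)
next
  case (compl A)
  note [measurable] = measurable_points_in[of UNIV, unfolded points_in_UNIV, simplified] compl.IH
  have "of_nat (points_in C {y. (y, x) \<in> UNIV \<times> space N - A}) =
      (of_nat (size C) - of_nat (points_in C {y. (y, x) \<in> A}) :: ennreal)" if "x \<in> space N" for C x
  proof -
    have "size C = points_in C {y. (y, x) \<in> UNIV \<times> space N - A} + points_in C {y. (y, x) \<in> A}"
      using that unfolding points_in_def size_union[symmetric]
      by (subst multiset_partition[of C "\<lambda>y. (y, x) \<notin> A"]) simp
    then show ?thesis by (simp add: ennreal_minus_cancel_iff)
  qed
  then have "(\<lambda>(C, x). of_nat (points_in C {y. (y, x) \<in> space borel \<times> space N - A}) :: ennreal) \<in>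
      borel_measurable (configurations \<Otimes>\<^sub>M N) \<longleftrightarrow>
      (\<lambda>(C, x). of_nat (size C) - of_nat (points_in C {y. (y, x) \<in> A}) :: ennreal) \<in>
      borel_measurable (configurations \<Otimes>\<^sub>M N)"
    by (intro measurable_cong) (auto simp: space_pair_measure)
  then show ?case by (auto simp: split_beta')
next
  case (union A)
  note [measurable] = union.IH
  have "of_nat (points_in C {y. (y, x) \<in> (\<Union>i. A i)}) =
      (\<Sum>i. of_nat (points_in C {y. (y, x) \<in> A i}) :: ennreal)" for C x
  proof -
    have "disjoint_family (\<lambda>i. {y. (y, x) \<in> A i})"
      using union(1) by (auto simp: disjoint_family_on_def)
    from suminf_points_in[OF this, of C] show ?thesis
      by (simp add: Collect_bex_eq[symmetric] flip: Collect_ex_eq)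
  qed
  then show ?case by (simp add: split_beta')
qed

section \<open>Exponential functionals of a Poisson process\<close>

text \<open>The function \<open>exp (s * T)\<close> extended to infinite totals, continuous along
  increasing sequences for s \<noteq> 0. For s = 0 the value at infinity is 0, not 1, so the
  exponent 0 is treated separately.\<close>

definition exp_ennreal :: "real \<Rightarrow> ennreal \<Rightarrow> ennreal" where
  "exp_ennreal s T = (if T = \<top> then (if s > 0 then \<top> else 0) else ennreal (exp (s * enn2real T)))"

lemma exp_ennreal_ennreal [simp]: "0 \<le> x \<Longrightarrow> exp_ennreal s (ennreal x) = ennreal (exp (s * x))"
  by (simp add: exp_ennreal_def)

lemma measurable_exp_ennreal [measurable]: "exp_ennreal s \<in> borel_measurable borel"
  unfolding exp_ennreal_def[abs_def] by measurable

lemma exp_ennreal_mono: "s > 0 \<Longrightarrow> T \<le> U \<Longrightarrow> exp_ennreal s T \<le> exp_ennreal s U"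
  by (auto simp: exp_ennreal_def top_unique less_top intro!: ennreal_leI enn2real_mono)

lemma exp_ennreal_antimono: "s < 0 \<Longrightarrow> T \<le> U \<Longrightarrow> exp_ennreal s U \<le> exp_ennreal s T"
  by (auto simp: exp_ennreal_def top_unique less_top intro!: ennreal_leI enn2real_mono)

lemma tendsto_exp_ennreal:
  fixes T :: "nat \<Rightarrow> ennreal"
  assumes s: "s \<noteq> 0" and T: "incseq T"
  shows "(\<lambda>n. exp_ennreal s (T n)) \<longlonglongrightarrow> exp_ennreal s (SUP n. T n)"
proof (cases "(SUP n. T n) = \<top>")
  case False
  have lim: "T \<longlonglongrightarrow> (SUP n. T n)" by (rule LIMSEQ_SUP[OF T])
  have "T n \<noteq> \<top>" for n
    using False SUP_upper[of n UNIV T] by (metis UNIV_I top_unique)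
  moreover have "(\<lambda>n. ennreal (exp (s * enn2real (T n)))) \<longlonglongrightarrow> ennreal (exp (s * enn2real (SUP n. T n)))"
    using False lim by (intro tendsto_intros tendsto_ennrealI tendsto_enn2real)
      (simp_all only: ennreal_enn2real_if if_False enn2real_nonneg)
  ultimately show ?thesis using False by (simp only: exp_ennreal_def if_False)
next
  case True
  have large: "eventually (\<lambda>n. ennreal K \<le> T n) sequentially" for K
  proof -
    have "T \<longlonglongrightarrow> \<top>" using LIMSEQ_SUP[OF T] True by simp
    then have "eventually (\<lambda>n. ennreal K < T n) sequentially"
      by (rule order_tendstoD) simp
    then show ?thesis by eventually_elim simp
  qed
  show ?thesis
  proof (cases "s > 0")
    case pos: True
    have "(\<lambda>n. exp_ennreal s (T n)) \<longlonglongrightarrow> \<top>"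
    proof (rule order_tendstoI)
      fix a :: ennreal assume "a < \<top>"
      then obtain r where r: "a = ennreal r" "r \<ge> 0" by (cases a) auto
      show "eventually (\<lambda>n. a < exp_ennreal s (T n)) sequentially"
        using large[of "r / s"]
      proof eventually_elim
        case (elim n)
        have "r < exp r" using exp_ge_add_one_self[of r] by linarith
        then have "r < exp (s * (r / s))" using pos by simp
        then have "a < exp_ennreal s (ennreal (r / s))"
          using pos r by (simp add: ennreal_less_iff)
        also have "\<dots> \<le> exp_ennreal s (T n)" by (rule exp_ennreal_mono[OF pos elim])
        finally show ?case .
      qed
    qed simp
    then show ?thesis using True pos by (simp add: exp_ennreal_def)
  next
    case False
    with s have neg: "s < 0" by simp
    have "(\<lambda>n. exp_ennreal s (T n)) \<longlonglongrightarrow> 0"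
    proof (rule order_tendstoI)
      fix a :: ennreal assume "0 < a"
      then obtain e where e: "0 < e" "ennreal e \<le> a"
        by (cases a) (auto intro: that[of "1::real"])
      \<comment> \<open>Chosen so that \<open>s * K\<close> is at most \<open>ln e - 1\<close>,
        hence \<open>exp (s * K) < e\<close>; the maximum keeps \<open>K\<close>
        nonnegative.\<close>
      define K where "K = max 0 (1 - ln e) / (- s)"
      have K: "0 \<le> K" "s * K = - max 0 (1 - ln e)"
        using neg by (simp_all add: K_def field_simps)
      show "eventually (\<lambda>n. exp_ennreal s (T n) < a) sequentially"
        using large[of K]
      proof eventually_elim
        case (elim n)
        have "exp_ennreal s (T n) \<le> exp_ennreal s (ennreal K)"
          by (rule exp_ennreal_antimono[OF neg elim])
        also have "\<dots> = ennreal (exp (- max 0 (1 - ln e)))"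
          by (simp only: exp_ennreal_ennreal[OF K(1)] K(2))
        also have "\<dots> < ennreal (exp (ln e))"
          by (rule ennreal_lessI) (auto simp del: exp_ln)
        also have "\<dots> \<le> a" using e by simp
        finally show ?case .
      qed
    qed simp
    then show ?thesis using True neg by (simp add: exp_ennreal_def)
  qed
qed

text \<open>Positive exponents give monotone convergence; negative ones reverse the order, but then
  the integrand is bounded by 1 and dominated convergence applies.\<close>

lemma (in prob_space) tendsto_integral_exp_ennreal:
  fixes T :: "nat \<Rightarrow> 'a \<Rightarrow> ennreal"
  assumes s: "s \<noteq> 0" and [measurable]: "\<And>n. T n \<in> borel_measurable M"
    and T: "\<And>\<omega>. incseq (\<lambda>n. T n \<omega>)"
  shows "(\<lambda>n. \<integral>\<^sup>+\<omega>. exp_ennreal s (T n \<omega>) \<partial>M) \<longlonglongrightarrow> (\<integral>\<^sup>+\<omega>. exp_ennreal s (SUP n. T n \<omega>) \<partial>M)"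
proof (cases "s > 0")
  case True
  show ?thesis
  proof (rule nn_integral_LIMSEQ)
    show "incseq (\<lambda>n \<omega>. exp_ennreal s (T n \<omega>))"
      using T by (auto simp: incseq_def le_fun_def intro!: exp_ennreal_mono[OF True])
  qed (use tendsto_exp_ennreal[OF s T] in auto)
next
  case False
  have "exp_ennreal s t \<le> 1" for t
    using False exp_ennreal_antimono[of s 0 t] s by (simp add: exp_ennreal_def)
  then show ?thesis
    using tendsto_exp_ennreal[OF s T]
    by (intro nn_integral_dominated_convergence[where w = "\<lambda>_. 1"]) (auto simp: emeasure_space_1)
qed

lemma sum_indicator_level_sets:
  fixes f :: "'a::euclidean_space \<Rightarrow> real"
  assumes f: "simple_function borel f"
  shows "(\<Sum>a\<in>range f - {0}. h a * indicator (f -` {a}) x) = (if f x = 0 then 0 else h (f x) :: real)"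
proof -
  have fin: "finite (range f - {0})" using f by (simp add: simple_function_def)
  have "(\<Sum>a\<in>range f - {0}. h a * indicator (f -` {a}) x) =
      (\<Sum>a\<in>range f - {0}. if f x = a then h a else 0)"
    by (intro sum.cong) (auto simp: indicator_def)
  then show ?thesis using fin by (simp add: sum.delta)
qed

lemma (in prob_space) nn_integral_exp_poisson:
  fixes N :: "'a \<Rightarrow> nat"
  assumes [measurable]: "N \<in> M \<rightarrow>\<^sub>M count_space UNIV"
    and N: "\<And>n. prob {\<omega> \<in> space M. N \<omega> = n} = \<mu> ^ n / fact n * exp (- \<mu>)" and "0 \<le> \<mu>"
  shows "(\<integral>\<^sup>+\<omega>. ennreal (exp (a * real (N \<omega>))) \<partial>M) = ennreal (exp (\<mu> * (exp a - 1)))"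
proof -
  have "(\<integral>\<^sup>+\<omega>. ennreal (exp (a * real (N \<omega>))) \<partial>M) =
      (\<integral>\<^sup>+\<omega>. (\<Sum>n. ennreal (exp (a * real n)) * indicator {\<omega> \<in> space M. N \<omega> = n} \<omega>) \<partial>M)"
  proof (rule nn_integral_cong)
    fix \<omega> assume "\<omega> \<in> space M"
    then show "ennreal (exp (a * real (N \<omega>))) =
        (\<Sum>n. ennreal (exp (a * real n)) * indicator {\<omega> \<in> space M. N \<omega> = n} \<omega>)"
      by (subst suminf_finite[of "{N \<omega>}"]) auto
  qed
  also have "\<dots> = (\<Sum>n. ennreal (exp (a * real n)) * emeasure M {\<omega> \<in> space M. N \<omega> = n})"
    by (subst nn_integral_suminf) (auto simp: nn_integral_cmult)
  also have "\<dots> = (\<Sum>n. ennreal ((\<mu> * exp a) ^ n / fact n * exp (- \<mu>)))"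
    using \<open>0 \<le> \<mu>\<close>
    by (intro suminf_cong)
       (simp add: emeasure_eq_measure N ennreal_mult[symmetric] power_mult_distrib exp_of_nat2_mult mult_ac)
  also have "\<dots> = ennreal (exp (\<mu> * exp a) * exp (- \<mu>))"
  proof (rule suminf_ennreal_eq)
    have "(\<lambda>n. (\<mu> * exp a) ^ n / fact n) sums exp (\<mu> * exp a)"
      using exp_converges[of "\<mu> * exp a"] by (simp add: scaleR_conv_of_real field_simps)
    then show "(\<lambda>n. (\<mu> * exp a) ^ n / fact n * exp (- \<mu>)) sums (exp (\<mu> * exp a) * exp (- \<mu>))"
      by (rule sums_mult2)
  qed (use \<open>0 \<le> \<mu>\<close> in simp)
  also have "exp (\<mu> * exp a) * exp (- \<mu>) = exp (\<mu> * (exp a - 1))"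
    by (simp add: exp_add[symmetric] algebra_simps)
  finally show ?thesis .
qed

text \<open>The level sets of nonzero values are disjoint, and bounded because \<open>f\<close>
  vanishes outside \<open>B\<close>, so their counts are independent Poisson variables and the
  expectation factors. The level set of 0 is unbounded and contributes nothing, which is why 0 is
  removed.\<close>

lemma (in prob_space) poisson_exp_simple:
  fixes I :: "'a \<Rightarrow> 'b::euclidean_space set" and f :: "'b \<Rightarrow> real"
  assumes I: "homogeneous_poisson_process M \<nu> I" and "0 < \<nu>"
    and f: "simple_function borel f" and supp: "\<And>x. x \<notin> B \<Longrightarrow> f x = 0" "bounded B"
  shows "(\<integral>\<^sup>+\<omega>. ennreal (exp (s * (\<Sum>a\<in>range f - {0}. a * real (card (I \<omega> \<inter> f -` {a}))))) \<partial>M) =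
    ennreal (exp (\<nu> * (\<Sum>a\<in>range f - {0}. (exp (s * a) - 1) * measure lborel (f -` {a}))))"
proof -
  let ?A = "range f - {0}" and ?S = "\<lambda>a. f -` {a}"
  have fin: "finite ?A" using f by (simp add: simple_function_def)
  have inj: "inj_on ?S ?A" by (rule inj_onI) auto
  have [measurable]: "f \<in> borel_measurable borel" using f by (rule borel_measurable_simple_function)
  have S: "?S a \<in> sets borel" for a
    using measurable_sets[of f borel borel "{a}"] by simp
  have bdd: "bounded (?S a)" if "a \<in> ?A" for a
    by (rule bounded_subset[OF supp(2)]) (use that supp(1) in auto)
  have "disjoint (?S ` ?A)" by (auto simp: disjoint_def)
  with fin S bdd have "indep_vars (\<lambda>_. count_space UNIV) (\<lambda>B \<omega>. card (I \<omega> \<inter> B)) (?S ` ?A)"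
    using I by (auto simp: homogeneous_poisson_process_def)
  \<comment> \<open>Independence is indexed by sets, not by values; \<open>the_inv_into\<close>
    recovers from a level set the value it belongs to.\<close>
  then have ind: "indep_vars (\<lambda>_. borel) (\<lambda>B \<omega>. ennreal (exp (s * (the_inv_into ?A ?S B * real (card (I \<omega> \<inter> B)))))) (?S ` ?A)"
    by (rule indep_vars_compose2) simp
  have card: "(\<lambda>\<omega>. card (I \<omega> \<inter> ?S a)) \<in> M \<rightarrow>\<^sub>M count_space UNIV"
     "\<And>n. prob {\<omega> \<in> space M. card (I \<omega> \<inter> ?S a) = n} =
         (\<nu> * measure lborel (?S a)) ^ n / fact n * exp (- (\<nu> * measure lborel (?S a)))" if "a \<in> ?A" for a
    using I S[of a] bdd[OF that] unfolding homogeneous_poisson_process_def by blast+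
  have "(\<integral>\<^sup>+\<omega>. ennreal (exp (s * (\<Sum>a\<in>?A. a * real (card (I \<omega> \<inter> ?S a))))) \<partial>M) =
      (\<integral>\<^sup>+\<omega>. (\<Prod>B\<in>?S`?A. ennreal (exp (s * (the_inv_into ?A ?S B * real (card (I \<omega> \<inter> B)))))) \<partial>M)"
    unfolding prod.reindex[OF inj] o_def
    by (intro nn_integral_cong)
       (simp add: the_inv_into_f_f[OF inj] sum_distrib_left exp_sum[OF fin] prod_ennreal)
  also have "\<dots> = (\<Prod>B\<in>?S`?A. \<integral>\<^sup>+\<omega>. ennreal (exp (s * (the_inv_into ?A ?S B * real (card (I \<omega> \<inter> B))))) \<partial>M)"
    by (rule indep_vars_nn_integral[OF _ ind]) (use fin in auto)
  also have "\<dots> = (\<Prod>a\<in>?A. \<integral>\<^sup>+\<omega>. ennreal (exp ((s * a) * real (card (I \<omega> \<inter> ?S a)))) \<partial>M)"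
    unfolding prod.reindex[OF inj] o_def
    by (intro prod.cong) (simp_all add: the_inv_into_f_f[OF inj] mult.assoc)
  also have "\<dots> = (\<Prod>a\<in>?A. ennreal (exp (\<nu> * measure lborel (?S a) * (exp (s * a) - 1))))"
    by (intro prod.cong refl nn_integral_exp_poisson card) (use \<open>0 < \<nu>\<close> in auto)
  also have "\<dots> = ennreal (exp (\<nu> * (\<Sum>a\<in>?A. (exp (s * a) - 1) * measure lborel (?S a))))"
    by (simp add: prod_ennreal exp_sum[OF fin, symmetric] sum_distrib_left mult_ac)
  finally show ?thesis .
qed

text \<open>Injectivity turns the series over indices into a sum over immigrants; only finitely many
  lie in \<open>B\<close>, and these are grouped by the value of \<open>f\<close>.\<close>

lemma suminf_simple_function_enumeration:
  fixes f :: "'b::euclidean_space \<Rightarrow> real" and X :: "nat \<Rightarrow> 'b"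
  assumes f: "simple_function borel f" and supp: "\<And>x. x \<notin> B \<Longrightarrow> f x = 0"
    and nonneg: "\<And>x. 0 \<le> f x" and X: "inj X" and fin: "finite (range X \<inter> B)"
  shows "(\<Sum>i. ennreal (f (X i))) = ennreal (\<Sum>a\<in>range f - {0}. a * real (card (range X \<inter> f -` {a})))"
proof -
  let ?N = "X -` (range X \<inter> B)" and ?A = "range f - {0}"
  have finN: "finite ?N" by (rule finite_vimageI[OF fin X])
  have finA: "finite (range f)" using f by (simp add: simple_function_def)
  have "(\<Sum>i. ennreal (f (X i))) = (\<Sum>i\<in>?N. ennreal (f (X i)))"
    by (rule suminf_finite[OF finN]) (use supp in auto)
  also have "\<dots> = ennreal (\<Sum>i\<in>?N. f (X i))"
    by (simp add: nonneg sum_ennreal)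
  also have "(\<Sum>i\<in>?N. f (X i)) = (\<Sum>x\<in>range X \<inter> B. f x)"
    by (rule sum.reindex_cong[symmetric, of X]) (use X in \<open>auto intro: inj_on_subset\<close>)
  also have "\<dots> = (\<Sum>a\<in>range f. \<Sum>x\<in>{x\<in>range X \<inter> B. f x = a}. f x)"
    by (rule sum.group[symmetric]) (use fin finA in auto)
  also have "\<dots> = (\<Sum>a\<in>?A. \<Sum>x\<in>{x\<in>range X \<inter> B. f x = a}. f x)"
    by (rule sum.mono_neutral_right) (use finA in auto)
  also have "\<dots> = (\<Sum>a\<in>?A. a * real (card (range X \<inter> f -` {a})))"
  proof (rule sum.cong)
    fix a assume a: "a \<in> ?A"
    have "f -` {a} \<subseteq> B" using a supp by auto
    then have "{x\<in>range X \<inter> B. f x = a} = range X \<inter> f -` {a}" by auto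
    moreover have "(\<Sum>x\<in>{x\<in>range X \<inter> B. f x = a}. f x) = (\<Sum>x\<in>{x\<in>range X \<inter> B. f x = a}. a)"
      by (rule sum.cong) auto
    ultimately show "(\<Sum>x\<in>{x\<in>range X \<inter> B. f x = a}. f x) = a * real (card (range X \<inter> f -` {a}))"
      by simp
  qed simp
  finally show ?thesis .
qed

text \<open>The exponential functional in a form covering both signs: for f \<ge> 0 and s = 1 or -1,
  \<open>exp (s * f x) - 1\<close> equals \<open>s * \<bar>exp (s * f x) - 1\<bar>\<close>, so
  pulling out \<open>s\<close> leaves a nonnegative integrand.\<close>

lemma (in prob_space) poisson_exp_functional_simple:
  fixes X :: "nat \<Rightarrow> 'a \<Rightarrow> 'b::euclidean_space" and f :: "'b \<Rightarrow> real"
  assumes I: "homogeneous_poisson_process M \<nu> (\<lambda>\<omega>. range (\<lambda>i. X i \<omega>))" and \<nu>: "0 < \<nu>"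
    and inj: "AE \<omega> in M. inj (\<lambda>i. X i \<omega>)"
    and f: "simple_function borel f" and supp: "\<And>x. x \<notin> B \<Longrightarrow> f x = 0" "bounded B"
    and nonneg: "\<And>x. 0 \<le> f x" and s: "s = 1 \<or> s = -1"
  shows "(\<integral>\<^sup>+\<omega>. exp_ennreal s (\<Sum>i. ennreal (f (X i \<omega>))) \<partial>M) =
    exp_ennreal s (\<integral>\<^sup>+x. ennreal (\<nu> * \<bar>exp (s * f x) - 1\<bar>) \<partial>lborel)"
proof -
  let ?A = "range f - {0}" and ?S = "\<lambda>a. f -` {a}"
  let ?m = "\<Sum>a\<in>?A. \<nu> * \<bar>exp (s * a) - 1\<bar> * measure lborel (?S a)"
  have finA: "finite ?A" using f by (simp add: simple_function_def)
  have [measurable]: "f \<in> borel_measurable borel" using f by (rule borel_measurable_simple_function)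
  have S [measurable]: "?S a \<in> sets borel" for a
    using measurable_sets[of f borel borel "{a}"] by simp
  have bdd: "bounded (?S a)" if "a \<in> ?A" for a
    by (rule bounded_subset[OF supp(2)]) (use that supp(1) in auto)
  have fin: "AE \<omega> in M. finite (range (\<lambda>i. X i \<omega>) \<inter> B)"
    using I supp(2) unfolding homogeneous_poisson_process_def by (auto elim: eventually_mono)
  have "(\<integral>\<^sup>+\<omega>. exp_ennreal s (\<Sum>i. ennreal (f (X i \<omega>))) \<partial>M) =
     (\<integral>\<^sup>+\<omega>. ennreal (exp (s * (\<Sum>a\<in>?A. a * real (card (range (\<lambda>i. X i \<omega>) \<inter> ?S a))))) \<partial>M)"
    using inj fin
  proof (intro nn_integral_cong_AE, eventually_elim)
    case (elim \<omega>)
    have "0 \<le> (\<Sum>a\<in>?A. a * real (card (range (\<lambda>i. X i \<omega>) \<inter> ?S a)))"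
      using nonneg by (intro sum_nonneg) auto
    then show ?case
      by (simp add: suminf_simple_function_enumeration[OF f supp(1) nonneg elim(3,4)])
  qed
  also have "\<dots> = ennreal (exp (\<nu> * (\<Sum>a\<in>?A. (exp (s * a) - 1) * measure lborel (?S a))))"
    by (rule poisson_exp_simple[OF I \<nu> f supp])
  also have "\<nu> * (\<Sum>a\<in>?A. (exp (s * a) - 1) * measure lborel (?S a)) = s * ?m"
    unfolding sum_distrib_left
  proof (rule sum.cong)
    fix a assume "a \<in> ?A"
    then have "a \<ge> 0" using nonneg by auto
    then have "exp (s * a) - 1 = s * \<bar>exp (s * a) - 1\<bar>" using s by auto
    then show "\<nu> * ((exp (s * a) - 1) * measure lborel (?S a)) = s * (\<nu> * \<bar>exp (s * a) - 1\<bar> * measure lborel (?S a))"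
      by (metis mult.assoc mult.left_commute)
  qed simp
  also have "ennreal (exp (s * ?m)) = exp_ennreal s (ennreal ?m)"
    using \<nu> by (intro exp_ennreal_ennreal[symmetric] sum_nonneg) auto
  also have "ennreal ?m = (\<integral>\<^sup>+x. ennreal (\<nu> * \<bar>exp (s * f x) - 1\<bar>) \<partial>lborel)"
  proof -
    have "(\<integral>\<^sup>+x. ennreal (\<nu> * \<bar>exp (s * f x) - 1\<bar>) \<partial>lborel) =
        (\<integral>\<^sup>+x. (\<Sum>a\<in>?A. ennreal (\<nu> * \<bar>exp (s * a) - 1\<bar>) * indicator (?S a) x) \<partial>lborel)"
    proof (rule nn_integral_cong)
      fix x
      have "(\<Sum>a\<in>?A. ennreal (\<nu> * \<bar>exp (s * a) - 1\<bar>) * indicator (?S a) x) =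
          (\<Sum>a\<in>?A. ennreal ((\<nu> * \<bar>exp (s * a) - 1\<bar>) * indicator (?S a) x))"
        by (intro sum.cong) (auto simp: indicator_def)
      also have "\<dots> = ennreal (\<Sum>a\<in>?A. (\<nu> * \<bar>exp (s * a) - 1\<bar>) * indicator (?S a) x)"
        using \<nu> by (intro sum_ennreal) auto
      also have "\<dots> = ennreal (\<nu> * \<bar>exp (s * f x) - 1\<bar>)"
        using sum_indicator_level_sets[OF f, of "\<lambda>a. \<nu> * \<bar>exp (s * a) - 1\<bar>" x] by simp
      finally show "ennreal (\<nu> * \<bar>exp (s * f x) - 1\<bar>) =
          (\<Sum>a\<in>?A. ennreal (\<nu> * \<bar>exp (s * a) - 1\<bar>) * indicator (?S a) x)" ..
    qed
    also have "\<dots> = (\<Sum>a\<in>?A. ennreal (\<nu> * \<bar>exp (s * a) - 1\<bar>) * emeasure lborel (?S a))"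
      by (subst nn_integral_sum) (auto simp: nn_integral_cmult)
    also have "\<dots> = (\<Sum>a\<in>?A. ennreal (\<nu> * \<bar>exp (s * a) - 1\<bar> * measure lborel (?S a)))"
      using \<nu> emeasure_bounded_finite[OF bdd]
      by (intro sum.cong) (auto simp: ennreal_mult emeasure_eq_ennreal_measure less_top)
    also have "\<dots> = ennreal ?m"
      using \<nu> by (intro sum_ennreal) auto
    finally show ?thesis ..
  qed
  finally show ?thesis .
qed

lemma (in prob_space) poisson_exp_functional:
  fixes X :: "nat \<Rightarrow> 'a \<Rightarrow> 'b::euclidean_space" and f :: "'b \<Rightarrow> real"
  assumes I: "homogeneous_poisson_process M \<nu> (\<lambda>\<omega>. range (\<lambda>i. X i \<omega>))" and \<nu>: "0 < \<nu>"
    and inj: "AE \<omega> in M. inj (\<lambda>i. X i \<omega>)" and X [measurable]: "\<And>i. X i \<in> borel_measurable M"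
    and f [measurable]: "f \<in> borel_measurable borel"
    and nonneg: "\<And>x. 0 \<le> f x" and s: "s = 1 \<or> s = -1"
  shows "(\<integral>\<^sup>+\<omega>. exp_ennreal s (\<Sum>i. ennreal (f (X i \<omega>))) \<partial>M) =
    exp_ennreal s (\<integral>\<^sup>+x. ennreal (\<nu> * \<bar>exp (s * f x) - 1\<bar>) \<partial>lborel)"
proof -
  obtain F where F: "incseq F" "\<And>k. simple_function borel (F k)" "\<And>x. bdd_above (range (\<lambda>k. F k x))"
      "\<And>k x. 0 \<le> F k x" "f = (SUP k. F k)"
    using borel_measurable_implies_simple_function_sequence_real[OF f nonneg] by blast
  \<comment> \<open>Cutting off at radius \<open>k\<close> gives the bounded support that the simple
    case needs, and keeps the sequence increasing.\<close>
  define g where "g k x = F k x * indicator (ball 0 (real k)) x" for k x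
  have g_mono: "g k x \<le> g l x" if "k \<le> l" for k l x
    using incseqD[OF F(1) that] F(4) that by (auto simp: g_def indicator_def le_fun_def)
  have g_nonneg: "0 \<le> g k x" for k x using F(4) by (simp add: g_def)
  have g_lim: "(\<lambda>k. g k x) \<longlonglongrightarrow> f x" for x
  proof -
    have "(\<lambda>k. F k x) \<longlonglongrightarrow> (SUP k. F k x)"
      using F(1,3) by (intro LIMSEQ_incseq_SUP) (auto simp: incseq_def le_fun_def)
    then have "(\<lambda>k. F k x) \<longlonglongrightarrow> f x" by (simp add: F(5) image_image)
    moreover have "eventually (\<lambda>k. F k x = g k x) sequentially"
    proof -
      obtain n where n: "norm x < real n" using reals_Archimedean2 by blast
      show ?thesis
        using eventually_ge_at_top[of n]
      proof eventually_elim
        case (elim k)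
        then have "real n \<le> real k" by simp
        with n have "norm x < real k" by linarith
        then show ?case by (simp add: g_def)
      qed
    qed
    ultimately show ?thesis by (rule Lim_transform_eventually)
  qed
  have g_simple: "simple_function borel (g k)" for k
    unfolding g_def by (intro simple_function_mult F(2) simple_function_indicator) auto
  then have [measurable]: "g k \<in> borel_measurable borel" for k
    by (rule borel_measurable_simple_function)
  have g_SUP: "(SUP k. ennreal (g k x)) = ennreal (f x)" for x
  proof (rule LIMSEQ_unique[OF LIMSEQ_SUP])
    show "incseq (\<lambda>k. ennreal (g k x))" by (auto intro!: incseq_SucI ennreal_leI g_mono)
    show "(\<lambda>k. ennreal (g k x)) \<longlonglongrightarrow> ennreal (f x)" by (intro tendsto_ennrealI g_lim)
  qed
  have s0: "s \<noteq> 0" using s by auto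
  \<comment> \<open>The absolute value increases with the nonnegative argument for either sign of
    \<open>s\<close>, so one monotone convergence argument serves both.\<close>
  have abs_mono: "\<bar>exp (s * a) - 1\<bar> \<le> \<bar>exp (s * b) - 1\<bar>" if "0 \<le> a" "a \<le> b" for a b :: real
    using s that by (auto simp: abs_if)
  have "(\<lambda>k. \<integral>\<^sup>+\<omega>. exp_ennreal s (\<Sum>i. ennreal (g k (X i \<omega>))) \<partial>M) \<longlonglongrightarrow>
      (\<integral>\<^sup>+\<omega>. exp_ennreal s (SUP k. \<Sum>i. ennreal (g k (X i \<omega>))) \<partial>M)"
    by (rule tendsto_integral_exp_ennreal[OF s0])
       (auto intro!: incseq_SucI suminf_le ennreal_leI g_mono)
  also have "(\<lambda>\<omega>. SUP k. \<Sum>i. ennreal (g k (X i \<omega>))) = (\<lambda>\<omega>. \<Sum>i. ennreal (f (X i \<omega>)))"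
    by (subst ennreal_suminf_SUP_eq[symmetric]) (auto intro!: incseq_SucI ennreal_leI g_mono simp: g_SUP)
  finally have 1: "(\<lambda>k. \<integral>\<^sup>+\<omega>. exp_ennreal s (\<Sum>i. ennreal (g k (X i \<omega>))) \<partial>M) \<longlonglongrightarrow>
      (\<integral>\<^sup>+\<omega>. exp_ennreal s (\<Sum>i. ennreal (f (X i \<omega>))) \<partial>M)" .
  let ?h = "\<lambda>k x. ennreal (\<nu> * \<bar>exp (s * g k x) - 1\<bar>)"
  have h_inc: "incseq (\<lambda>k x. ?h k x)"
    using \<nu> by (auto simp: incseq_def le_fun_def intro!: ennreal_leI mult_left_mono abs_mono g_mono g_nonneg)
  have "(\<lambda>k. exp_ennreal s (\<integral>\<^sup>+x. ?h k x \<partial>lborel)) \<longlonglongrightarrow> exp_ennreal s (SUP k. \<integral>\<^sup>+x. ?h k x \<partial>lborel)"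
    using h_inc by (intro tendsto_exp_ennreal[OF s0]) (auto simp: incseq_def le_fun_def intro!: nn_integral_mono)
  also have "(SUP k. \<integral>\<^sup>+x. ?h k x \<partial>lborel) = (\<integral>\<^sup>+x. (SUP k. ?h k x) \<partial>lborel)"
    using h_inc by (intro nn_integral_monotone_convergence_SUP[symmetric]) auto
  also have "\<dots> = (\<integral>\<^sup>+x. ennreal (\<nu> * \<bar>exp (s * f x) - 1\<bar>) \<partial>lborel)"
  proof (rule nn_integral_cong, rule LIMSEQ_unique[OF LIMSEQ_SUP])
    fix x
    show "incseq (\<lambda>k. ?h k x)" using h_inc by (auto simp: incseq_def le_fun_def)
    show "(\<lambda>k. ?h k x) \<longlonglongrightarrow> ennreal (\<nu> * \<bar>exp (s * f x) - 1\<bar>)"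
      by (intro tendsto_intros tendsto_ennrealI g_lim)
  qed
  finally have 2: "(\<lambda>k. exp_ennreal s (\<integral>\<^sup>+x. ?h k x \<partial>lborel)) \<longlonglongrightarrow>
      exp_ennreal s (\<integral>\<^sup>+x. ennreal (\<nu> * \<bar>exp (s * f x) - 1\<bar>) \<partial>lborel)" .
  have "(\<integral>\<^sup>+\<omega>. exp_ennreal s (\<Sum>i. ennreal (g k (X i \<omega>))) \<partial>M) = exp_ennreal s (\<integral>\<^sup>+x. ?h k x \<partial>lborel)" for k
    by (rule poisson_exp_functional_simple[OF I \<nu> inj g_simple _ bounded_ball g_nonneg s, of "0" "real k"])
       (simp add: g_def)
  with 1 2 show ?thesis by (simp add: LIMSEQ_unique)
qed

section \<open>Moment generating function of a cluster process\<close>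

text \<open>Turns independence of the generated sigma-algebras into a product law, so that Fubini
  can freeze the immigrants.\<close>

lemma (in prob_space) distr_pair_indep_set:
  assumes X: "X \<in> M \<rightarrow>\<^sub>M S" and Y: "Y \<in> M \<rightarrow>\<^sub>M T"
    and indep: "indep_set (sets (vimage_algebra (space M) X S)) (sets (vimage_algebra (space M) Y T))"
  shows "distr M S X \<Otimes>\<^sub>M distr M T Y = distr M (S \<Otimes>\<^sub>M T) (\<lambda>\<omega>. (X \<omega>, Y \<omega>))"
proof (rule pair_measure_eqI)
  show "sigma_finite_measure (distr M S X)" "sigma_finite_measure (distr M T Y)"
    using prob_space_distr[OF X] prob_space_distr[OF Y]
    by (auto intro: prob_space_imp_sigma_finite)
  fix A B assume A: "A \<in> sets (distr M S X)" and B: "B \<in> sets (distr M T Y)"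
  let ?a = "X -` A \<inter> space M" and ?b = "Y -` B \<inter> space M"
  have ab: "?a \<in> sets (vimage_algebra (space M) X S)" "?b \<in> sets (vimage_algebra (space M) Y T)"
    using A B by (auto intro: in_vimage_algebra)
  have "prob (?a \<inter> ?b) = prob ?a * prob ?b"
    by (rule indep_setD[OF indep ab])
  moreover have "(\<lambda>\<omega>. (X \<omega>, Y \<omega>)) -` (A \<times> B) \<inter> space M = ?a \<inter> ?b" by auto
  moreover have "A \<times> B \<in> sets (S \<Otimes>\<^sub>M T)" using A B by auto
  ultimately show "emeasure (distr M S X) A * emeasure (distr M T Y) B =
      emeasure (distr M (S \<Otimes>\<^sub>M T) (\<lambda>\<omega>. (X \<omega>, Y \<omega>))) (A \<times> B)"
    using A B X Y
    by (simp add: emeasure_distr measurable_Pair emeasure_eq_measure ennreal_mult)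
qed simp

lemma norm_le_cluster_radius: "y \<in># C \<Longrightarrow> norm y \<le> cluster_radius C"
  unfolding cluster_radius_def by (rule cSUP_upper) auto

lemma cluster_radius_nonneg:
  assumes "C \<noteq> {#}"
  shows "0 \<le> cluster_radius C"
proof -
  obtain y where "y \<in># C" using assms by blast
  then show ?thesis using norm_le_cluster_radius[of y C] norm_ge_zero[of y] by linarith
qed

lemma measurable_size [measurable]:
  "size \<in> (configurations :: 'a::topological_space multiset measure) \<rightarrow>\<^sub>M count_space UNIV"
  using measurable_points_in[of UNIV] by (simp add: points_in_UNIV)

text \<open>The radius is at most \<open>a\<close> exactly when no point lies outside the closed
  ball. The empty configuration, where the supremum is just some fixed constant, is split
  off.\<close>

lemma measurable_cluster_radius [measurable]:
  "cluster_radius \<in> borel_measurable (configurations :: 'a::euclidean_space multiset measure)"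
proof (rule borel_measurableI_le)
  fix a :: real
  have [measurable]: "(\<lambda>C. points_in C (- cball (0::'a) a)) \<in> configurations \<rightarrow>\<^sub>M count_space UNIV"
    by (rule measurable_points_in) auto
  have "cluster_radius C \<le> a \<longleftrightarrow> points_in C (- cball 0 a) = 0" if "C \<noteq> {#}" for C :: "'a multiset"
  proof -
    have "cluster_radius C \<le> a \<longleftrightarrow> (\<forall>y\<in>#C. norm y \<le> a)"
      unfolding cluster_radius_def by (rule cSUP_le_iff) (use that in auto)
    also have "\<dots> \<longleftrightarrow> points_in C (- cball 0 a) = 0"
      by (simp add: points_in_eq_0_iff)
    finally show ?thesis .
  qed
  then have "{C \<in> space configurations. cluster_radius C \<le> a} =
    {C \<in> space (configurations :: 'a multiset measure). if size C = 0 then cluster_radius ({#} :: 'a multiset) \<le> a else points_in C (- cball 0 a) = 0}"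
    by (intro Collect_cong) (metis size_eq_0_iff_empty)
  also have "\<dots> \<in> sets configurations" by measurable
  finally show "{C \<in> space configurations. cluster_radius C \<le> a} \<in> sets (configurations :: 'a multiset measure)" .
qed

lemma measurable_points_in_translate:
  assumes "B \<in> sets borel"
  shows "(\<lambda>(C, x). of_nat (points_in C {y. y + x \<in> B}) :: ennreal) \<in>
    borel_measurable (configurations \<Otimes>\<^sub>M (borel :: 'a::euclidean_space measure))"
proof -
  have "(\<lambda>p. fst p + snd p) -` B \<inter> space (borel \<Otimes>\<^sub>M borel) \<in> sets (borel \<Otimes>\<^sub>M (borel :: 'a measure))"
    using assms by measurable
  from measurable_points_in_section[OF this] show ?thesis
    by (simp add: vimage_def space_pair_measure)
qed

locale poisson_cluster =
  fixes M :: "'w measure" and \<nu> :: real and Q :: "'a::euclidean_space multiset measure"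
    and X :: "nat \<Rightarrow> 'w \<Rightarrow> 'a" and C :: "nat \<Rightarrow> 'w \<Rightarrow> 'a multiset"
  assumes process: "poisson_cluster_process M \<nu> Q X C" and \<nu>_pos: "0 < \<nu>"

sublocale poisson_cluster \<subseteq> prob_space M
  using process by (simp add: poisson_cluster_process_def)

context poisson_cluster
begin

abbreviation K :: "nat \<Rightarrow> 'w \<Rightarrow> 'a multiset" where
  "K \<equiv> centered_cluster X C"

abbreviation count_at :: "'a set \<Rightarrow> 'a \<Rightarrow> 'a multiset \<Rightarrow> real" where
  "count_at B x c \<equiv> real (points_in c {y. y + x \<in> B})"

definition total :: "'a set \<Rightarrow> 'w \<Rightarrow> ennreal" where
  "total B \<omega> = (\<Sum>i. of_nat (points_in (C i \<omega>) B))"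

lemma
  shows measurable_X [measurable]: "\<And>i. X i \<in> borel_measurable M"
    and inj_X: "AE \<omega> in M. inj (\<lambda>i. X i \<omega>)"
    and immigrants: "homogeneous_poisson_process M \<nu> (\<lambda>\<omega>. range (\<lambda>i. X i \<omega>))"
    and immigrant_in_cluster: "AE \<omega> in M. \<forall>i. X i \<omega> \<in># C i \<omega>"
    and measurable_K [measurable]: "\<And>i. K i \<in> M \<rightarrow>\<^sub>M configurations"
    and distr_K: "\<And>i. distr M configurations (K i) = Q"
    and indep_K: "indep_vars (\<lambda>_. configurations) K UNIV"
    and indep_X_K: "indep_set
       (sets (vimage_algebra (space M) (\<lambda>\<omega> i. X i \<omega>) (\<Pi>\<^sub>M i\<in>UNIV. borel)))
       (sets (vimage_algebra (space M) (\<lambda>\<omega> i. K i \<omega>) (\<Pi>\<^sub>M i\<in>UNIV. configurations)))"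
  using process by (simp_all add: poisson_cluster_process_def)

lemma prob_space_Q: "prob_space Q"
  using prob_space_distr[OF measurable_K[of 0]] by (simp add: distr_K)

lemma sets_Q [measurable_cong]: "sets Q = sets configurations"
  by (metis distr_K sets_distr)

text \<open>Each cluster contains its immigrant. This excludes empty configurations, whose radius
  would be meaningless, and drives the estimates of the exponential moment.\<close>

lemma AE_size_pos: "AE c in Q. 1 \<le> size c"
proof -
  have "AE \<omega> in M. 1 \<le> size (K 0 \<omega>)"
    using immigrant_in_cluster
  proof eventually_elim
    case (elim \<omega>)
    then have "C 0 \<omega> \<noteq> {#}" by (metis empty_iff set_mset_empty)
    then show ?case by (simp add: centered_cluster_def Suc_le_eq nonempty_has_size)
  qed
  have "{c \<in> space configurations. 1 \<le> size c} \<in> sets (configurations :: 'a multiset measure)"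
    by measurable
  from AE_distr_iff[OF measurable_K[of 0] this] \<open>AE \<omega> in M. 1 \<le> size (K 0 \<omega>)\<close> show ?thesis
    unfolding distr_K by blast
qed

lemma points_in_cluster: "points_in (C i \<omega>) B = points_in (K i \<omega>) {y. y + X i \<omega> \<in> B}"
  by (simp add: centered_cluster_def points_in_image_mset vimage_def)

lemma measurable_count_at:
  assumes "B \<in> sets borel"
  shows "(\<lambda>(c, x). count_at B x c) \<in> borel_measurable (configurations \<Otimes>\<^sub>M borel)"
using borel_measurable_enn2real[OF measurable_points_in_translate[OF assms]]
  by (simp add: split_beta')

lemma measurable_points_in_cluster:
  assumes "B \<in> sets borel"
  shows "(\<lambda>\<omega>. real (points_in (C i \<omega>) B)) \<in> borel_measurable M"
proof -
  have "(\<lambda>\<omega>. (K i \<omega>, X i \<omega>)) \<in> M \<rightarrow>\<^sub>M configurations \<Otimes>\<^sub>M borel" by measurable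
  from measurable_compose[OF this measurable_count_at[OF assms]] show ?thesis
    by (simp add: points_in_cluster)
qed

lemma measurable_total:
  assumes "B \<in> sets borel"
  shows "total B \<in> borel_measurable M"
proof -
  note [measurable] = measurable_points_in_cluster[OF assms]
  show ?thesis
    unfolding total_def[abs_def] ennreal_of_nat_eq_real_of_nat by measurable
qed

lemma measurable_cluster_process_count:
  "B \<in> sets borel \<Longrightarrow> cluster_process_count C B \<in> borel_measurable M"
  using borel_measurable_enn2real[OF measurable_total]
  unfolding cluster_process_count_def[abs_def] total_def[abs_def] .

text \<open>The joint law of positions and centered clusters is a product, so for frozen positions
  the centered clusters are still independent with law \<open>Q\<close> and the expectation factors.
  Finitely many factors suffice; the whole series is reached later by a limit.\<close>

lemma nn_integral_prod_clusters:
  assumes \<phi>: "(\<lambda>(x, c). \<phi> x c :: ennreal) \<in> borel_measurable (borel \<Otimes>\<^sub>M configurations)"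
  shows "(\<integral>\<^sup>+\<omega>. (\<Prod>i<n. \<phi> (X i \<omega>) (K i \<omega>)) \<partial>M) = (\<integral>\<^sup>+\<omega>. (\<Prod>i<n. \<integral>\<^sup>+c. \<phi> (X i \<omega>) c \<partial>Q) \<partial>M)"
proof -
  let ?SX = "\<Pi>\<^sub>M i\<in>(UNIV::nat set). (borel :: 'a measure)"
  let ?SK = "\<Pi>\<^sub>M i\<in>(UNIV::nat set). (configurations :: 'a multiset measure)"
  let ?X = "\<lambda>\<omega> i. X i \<omega>" and ?K = "\<lambda>\<omega> i. K i \<omega>"
  interpret Q: prob_space Q by (rule prob_space_Q)
  have \<phi>1 [measurable (raw)]: "(\<lambda>z. \<phi> (f z) (g z)) \<in> borel_measurable N"
    if "f \<in> borel_measurable N" "g \<in> N \<rightarrow>\<^sub>M configurations" for f g and N :: "'z measure"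
    using measurable_compose[OF measurable_Pair[OF that] \<phi>] by simp
  have X [measurable]: "?X \<in> M \<rightarrow>\<^sub>M ?SX" and K [measurable]: "?K \<in> M \<rightarrow>\<^sub>M ?SK"
    by (auto intro!: measurable_PiM_single')
  have joint: "distr M ?SX ?X \<Otimes>\<^sub>M distr M ?SK ?K = distr M (?SX \<Otimes>\<^sub>M ?SK) (\<lambda>\<omega>. (?X \<omega>, ?K \<omega>))"
    by (rule distr_pair_indep_set[OF X K indep_X_K])
  interpret K: prob_space "distr M ?SK ?K" by (rule prob_space_distr[OF K])
  let ?F = "\<lambda>x k. \<Prod>i<n. \<phi> (x i) (k i)"
  have F [measurable]: "(\<lambda>p. ?F (fst p) (snd p)) \<in> borel_measurable (?SX \<Otimes>\<^sub>M ?SK)"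
    by (intro borel_measurable_prod_ennreal \<phi>1) measurable
  have inner: "(\<integral>\<^sup>+\<omega>. ?F x (?K \<omega>) \<partial>M) = (\<Prod>i<n. \<integral>\<^sup>+c. \<phi> (x i) c \<partial>Q)" for x
  proof -
    have "indep_vars (\<lambda>_. borel) (\<lambda>i \<omega>. \<phi> (x i) (K i \<omega>)) {..<n}"
      by (rule indep_vars_compose2[OF indep_vars_subset[OF indep_K]]) measurable
    then have "(\<integral>\<^sup>+\<omega>. ?F x (?K \<omega>) \<partial>M) = (\<Prod>i<n. \<integral>\<^sup>+\<omega>. \<phi> (x i) (K i \<omega>) \<partial>M)"
      by (intro indep_vars_nn_integral) auto
    also have "\<dots> = (\<Prod>i<n. \<integral>\<^sup>+c. \<phi> (x i) c \<partial>Q)"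
    proof (rule prod.cong)
      fix i
      show "(\<integral>\<^sup>+\<omega>. \<phi> (x i) (K i \<omega>) \<partial>M) = (\<integral>\<^sup>+c. \<phi> (x i) c \<partial>Q)"
        unfolding distr_K[of i, symmetric] by (subst nn_integral_distr) measurable
    qed simp
    finally show ?thesis .
  qed
  have "(\<integral>\<^sup>+\<omega>. ?F (?X \<omega>) (?K \<omega>) \<partial>M) =
      (\<integral>\<^sup>+p. ?F (fst p) (snd p) \<partial>(distr M (?SX \<Otimes>\<^sub>M ?SK) (\<lambda>\<omega>. (?X \<omega>, ?K \<omega>))))"
    by (subst nn_integral_distr) (use F in \<open>auto intro!: measurable_Pair X K\<close>)
  also have "\<dots> = (\<integral>\<^sup>+p. ?F (fst p) (snd p) \<partial>(distr M ?SX ?X \<Otimes>\<^sub>M distr M ?SK ?K))"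
    by (simp only: joint)
  also have "\<dots> = (\<integral>\<^sup>+x. \<integral>\<^sup>+k. ?F x k \<partial>(distr M ?SK ?K) \<partial>(distr M ?SX ?X))"
    by (subst K.nn_integral_fst[symmetric]) (use F in \<open>auto cong: measurable_cong_sets\<close>)
  also have "\<dots> = (\<integral>\<^sup>+x. (\<Prod>i<n. \<integral>\<^sup>+c. \<phi> (x i) c \<partial>Q) \<partial>(distr M ?SX ?X))"
  proof (rule nn_integral_cong)
    fix x
    have "?F x \<in> borel_measurable ?SK"
      by (intro borel_measurable_prod_ennreal \<phi>1) measurable
    then show "(\<integral>\<^sup>+k. ?F x k \<partial>(distr M ?SK ?K)) = (\<Prod>i<n. \<integral>\<^sup>+c. \<phi> (x i) c \<partial>Q)"
      by (simp add: nn_integral_distr inner)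
  qed
  also have "\<dots> = (\<integral>\<^sup>+\<omega>. (\<Prod>i<n. \<integral>\<^sup>+c. \<phi> (X i \<omega>) c \<partial>Q) \<partial>M)"
  proof -
    have *: "(\<lambda>x. \<integral>\<^sup>+c. \<phi> x c \<partial>Q) \<in> borel_measurable borel"
      using \<phi> by (intro Q.borel_measurable_nn_integral) measurable
    have "(\<lambda>x. \<Prod>i<n. \<integral>\<^sup>+c. \<phi> (x i) c \<partial>Q) \<in> borel_measurable ?SX"
      by (intro borel_measurable_prod_ennreal measurable_compose[OF _ *]) measurable
    then show ?thesis by (intro nn_integral_distr X) simp
  qed
  finally show ?thesis .
qed

end

lemma sgn_exp_minus_1_nonneg:
  fixes \<theta> t :: real
  shows "0 \<le> t \<Longrightarrow> 0 \<le> sgn \<theta> * (exp (\<theta> * t) - 1)"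
  by (auto simp: sgn_if mult_nonpos_nonneg)

lemma exp_ennreal_sum_of_nat:
  fixes p :: "nat \<Rightarrow> nat"
  shows "exp_ennreal \<theta> (\<Sum>i<n. ennreal (real (p i))) = (\<Prod>i<n. ennreal (exp (\<theta> * real (p i))))"
  by (simp add: sum_nonneg sum_distrib_left exp_sum prod_ennreal)

section \<open>Moment generating function of the total count\<close>

context poisson_cluster
begin

definition exp_moment :: "real \<Rightarrow> real" where
  "exp_moment \<theta> = (\<integral>c. exp (\<theta> * real (size c)) \<partial>Q)"

definition cluster_mgf :: "real \<Rightarrow> 'a set \<Rightarrow> 'a \<Rightarrow> real" where
  "cluster_mgf \<theta> B x = (\<integral>c. exp (\<theta> * count_at B x c) \<partial>Q)"

lemma count_at_measurable_Q:
  assumes "B \<in> sets borel"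
  shows "count_at B x \<in> borel_measurable Q"
  using measurable_compose[OF measurable_Pair2' measurable_count_at[OF assms]]
  by (simp add: measurable_cong_sets[OF sets_Q refl])

lemma exp_count_bounds:
  assumes "s = sgn \<theta>"
  shows "0 \<le> s * (exp (\<theta> * count_at B x c) - 1)"
    and "s * (exp (\<theta> * count_at B x c) - 1) \<le> s * (exp (\<theta> * real (size c)) - 1)"
proof -
  have *: "0 \<le> count_at B x c" "count_at B x c \<le> real (size c)"
    by (simp_all add: points_in_le_size)
  show "0 \<le> s * (exp (\<theta> * count_at B x c) - 1)"
    unfolding assms by (rule sgn_exp_minus_1_nonneg) simp
  show "s * (exp (\<theta> * count_at B x c) - 1) \<le> s * (exp (\<theta> * real (size c)) - 1)"
    unfolding assms sgn_if using * by (auto intro: mult_left_mono mult_left_mono_neg)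
qed

lemma integrable_exp_count:
  assumes B: "B \<in> sets borel" and int: "integrable Q (\<lambda>c. exp (\<theta> * real (size c)))"
  shows "integrable Q (\<lambda>c. exp (\<theta> * count_at B x c))"
proof -
  interpret Q: prob_space Q by (rule prob_space_Q)
  note [measurable] = count_at_measurable_Q[OF B]
  have "integrable Q (\<lambda>c. exp (\<theta> * real (size c)) + 1)" using int by simp
  then show ?thesis
  proof (rule Bochner_Integration.integrable_bound)
    have "exp (\<theta> * count_at B x c) \<le> exp (\<theta> * real (size c)) + 1" for c
    proof (cases "\<theta> \<ge> 0")
      case True
      then have "exp (\<theta> * count_at B x c) \<le> exp (\<theta> * real (size c))"
        by (simp add: mult_left_mono points_in_le_size)
      then show ?thesis by linarith
    next
      case False
      then have "exp (\<theta> * count_at B x c) \<le> 1" by (simp add: mult_nonpos_nonneg)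
      then show ?thesis by (simp add: add_increasing)
    qed
    then show "AE c in Q. norm (exp (\<theta> * count_at B x c)) \<le> norm (exp (\<theta> * real (size c)) + 1)"
      by (simp add: abs_of_pos add_pos_pos)
  qed measurable
qed

lemma cluster_mgf_pos:
  assumes "B \<in> sets borel" "integrable Q (\<lambda>c. exp (\<theta> * real (size c)))"
  shows "0 < cluster_mgf \<theta> B x"
proof -
  interpret Q: prob_space Q by (rule prob_space_Q)
  show ?thesis
    unfolding cluster_mgf_def
    by (rule Q.integral_exp_pos[OF integrable_exp_count[OF assms]])
qed

lemma ennreal_cluster_mgf_minus_1:
  assumes B: "B \<in> sets borel" and int: "integrable Q (\<lambda>c. exp (\<theta> * real (size c)))" and s: "s = sgn \<theta>"
  shows "ennreal (s * (cluster_mgf \<theta> B x - 1)) = (\<integral>\<^sup>+c. ennreal (s * (exp (\<theta> * count_at B x c) - 1)) \<partial>Q)"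
proof -
  interpret Q: prob_space Q by (rule prob_space_Q)
  note i = integrable_exp_count[OF B int, of x]
  have "(\<integral>\<^sup>+c. ennreal (s * (exp (\<theta> * count_at B x c) - 1)) \<partial>Q) =
      ennreal (\<integral>c. s * (exp (\<theta> * count_at B x c) - 1) \<partial>Q)"
    using i exp_count_bounds(1)[OF s] by (intro nn_integral_eq_integral) auto
  also have "(\<integral>c. s * (exp (\<theta> * count_at B x c) - 1) \<partial>Q) = s * (cluster_mgf \<theta> B x - 1)"
    using i by (simp add: cluster_mgf_def Q.prob_space)
  finally show ?thesis ..
qed

lemma cluster_mgf_sign:
  assumes B: "B \<in> sets borel" and int: "integrable Q (\<lambda>c. exp (\<theta> * real (size c)))" and s: "s = sgn \<theta>"
  shows "0 \<le> s * (cluster_mgf \<theta> B x - 1)"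
proof -
  interpret Q: prob_space Q by (rule prob_space_Q)
  note i = integrable_exp_count[OF B int, of x]
  have "0 \<le> (\<integral>c. s * (exp (\<theta> * count_at B x c) - 1) \<partial>Q)"
    using exp_count_bounds(1)[OF s] by (intro integral_nonneg_AE) auto
  also have "(\<integral>c. s * (exp (\<theta> * count_at B x c) - 1) \<partial>Q) = s * (cluster_mgf \<theta> B x - 1)"
    using i by (simp add: cluster_mgf_def Q.prob_space)
  finally show ?thesis .
qed

lemma measurable_cluster_mgf:
  assumes "B \<in> sets borel"
  shows "cluster_mgf \<theta> B \<in> borel_measurable borel"
proof -
  interpret Q: prob_space Q by (rule prob_space_Q)
  have "(\<lambda>(x, c). count_at B x c) \<in> borel_measurable (borel \<Otimes>\<^sub>M Q)"
    using measurable_compose[OF measurable_pair_swap' measurable_count_at[OF assms]]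
    by (simp add: split_beta' measurable_cong_sets[OF sets_pair_measure_cong[OF refl sets_Q] refl])
  then have "(\<lambda>(x, c). exp (\<theta> * count_at B x c)) \<in> borel_measurable (borel \<Otimes>\<^sub>M Q)"
    by (simp add: split_beta')
  then show ?thesis
    unfolding cluster_mgf_def[abs_def] by (rule Q.borel_measurable_lebesgue_integral)
qed

text \<open>Conditioning on the immigrants replaces each cluster by its own moment generating
  function, which leaves an exponential functional of the Poisson process alone.\<close>

lemma mgf_total:
  assumes B: "B \<in> sets borel" and int: "integrable Q (\<lambda>c. exp (\<theta> * real (size c)))"
    and \<theta>: "\<theta> \<noteq> 0" and s: "s = sgn \<theta>"
  shows "(\<integral>\<^sup>+\<omega>. exp_ennreal \<theta> (total B \<omega>) \<partial>M) =
    exp_ennreal s (\<integral>\<^sup>+x. ennreal (\<nu> * (s * (cluster_mgf \<theta> B x - 1))) \<partial>lborel)"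
proof -
  interpret Q: prob_space Q by (rule prob_space_Q)
  note [measurable] = measurable_points_in_cluster[OF B] measurable_cluster_mgf[OF B]
  have s1: "s = 1 \<or> s = -1" using s \<theta> by (auto simp: sgn_if)
  then have s0: "s \<noteq> 0" "s * s = 1" by auto
  \<comment> \<open>The nonnegative function with
    \<open>exp (s * f x) = cluster_mgf \<theta> B x\<close>; the sign is needed because the
    generating function is at most 1 when \<theta> < 0.\<close>
  define f where "f x = s * ln (cluster_mgf \<theta> B x)" for x
  note pos = cluster_mgf_pos[OF B int]
  have [measurable]: "f \<in> borel_measurable borel" unfolding f_def by measurable
  have f_nonneg: "0 \<le> f x" for x
    using cluster_mgf_sign[OF B int s, of x] s1 pos[of x] by (auto simp: f_def)
  have exp_f: "exp (s * f x) = cluster_mgf \<theta> B x" for x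
    using s0 pos[of x] by (simp add: f_def mult.assoc[symmetric])
  \<comment> \<open>The identity is exact for the first \<open>n\<close> clusters and both sides
    converge as \<open>n\<close> grows, so no infinite product has to be handled.\<close>
  have partial: "(\<integral>\<^sup>+\<omega>. exp_ennreal \<theta> (\<Sum>i<n. of_nat (points_in (C i \<omega>) B)) \<partial>M) =
      (\<integral>\<^sup>+\<omega>. exp_ennreal s (\<Sum>i<n. ennreal (f (X i \<omega>))) \<partial>M)" for n
  proof -
    let ?\<phi> = "\<lambda>x c. ennreal (exp (\<theta> * count_at B x c))"
    have \<phi>: "(\<lambda>(x, c). ?\<phi> x c) \<in> borel_measurable (borel \<Otimes>\<^sub>M configurations)"
      using measurable_compose[OF measurable_pair_swap' measurable_count_at[OF B]]
      by (simp add: split_beta')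
    have "(\<integral>\<^sup>+\<omega>. exp_ennreal \<theta> (\<Sum>i<n. of_nat (points_in (C i \<omega>) B)) \<partial>M) =
        (\<integral>\<^sup>+\<omega>. (\<Prod>i<n. ?\<phi> (X i \<omega>) (K i \<omega>)) \<partial>M)"
      unfolding ennreal_of_nat_eq_real_of_nat exp_ennreal_sum_of_nat points_in_cluster ..
    also have "\<dots> = (\<integral>\<^sup>+\<omega>. (\<Prod>i<n. \<integral>\<^sup>+c. ?\<phi> (X i \<omega>) c \<partial>Q) \<partial>M)"
      by (rule nn_integral_prod_clusters[OF \<phi>])
    also have "\<dots> = (\<integral>\<^sup>+\<omega>. (\<Prod>i<n. ennreal (exp (s * f (X i \<omega>)))) \<partial>M)"
      unfolding exp_f cluster_mgf_def
      by (subst nn_integral_eq_integral[OF integrable_exp_count[OF B int]]) auto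
    also have "\<dots> = (\<integral>\<^sup>+\<omega>. exp_ennreal s (\<Sum>i<n. ennreal (f (X i \<omega>))) \<partial>M)"
      by (simp add: f_nonneg sum_ennreal sum_nonneg sum_distrib_left exp_sum prod_ennreal)
    finally show ?thesis .
  qed
  have sum_lim: "(\<Sum>i. g i) = (SUP n. \<Sum>i<n. g i)" for g :: "nat \<Rightarrow> ennreal"
    by (rule suminf_eq_SUP)
  have "(\<lambda>n. \<integral>\<^sup>+\<omega>. exp_ennreal \<theta> (\<Sum>i<n. of_nat (points_in (C i \<omega>) B)) \<partial>M) \<longlonglongrightarrow>
      (\<integral>\<^sup>+\<omega>. exp_ennreal \<theta> (total B \<omega>) \<partial>M)"
    unfolding total_def sum_lim ennreal_of_nat_eq_real_of_nat
    by (rule tendsto_integral_exp_ennreal[OF \<theta>]) (auto intro!: incseq_SucI simp del: sum_ennreal)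
  moreover have "(\<lambda>n. \<integral>\<^sup>+\<omega>. exp_ennreal s (\<Sum>i<n. ennreal (f (X i \<omega>))) \<partial>M) \<longlonglongrightarrow>
      (\<integral>\<^sup>+\<omega>. exp_ennreal s (\<Sum>i. ennreal (f (X i \<omega>))) \<partial>M)"
    unfolding sum_lim
    by (rule tendsto_integral_exp_ennreal[OF s0(1)]) (auto intro!: incseq_SucI)
  ultimately have "(\<integral>\<^sup>+\<omega>. exp_ennreal \<theta> (total B \<omega>) \<partial>M) =
      (\<integral>\<^sup>+\<omega>. exp_ennreal s (\<Sum>i. ennreal (f (X i \<omega>))) \<partial>M)"
    unfolding partial by (rule LIMSEQ_unique)
  also have "\<dots> = exp_ennreal s (\<integral>\<^sup>+x. ennreal (\<nu> * \<bar>exp (s * f x) - 1\<bar>) \<partial>lborel)"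
    by (rule poisson_exp_functional[OF immigrants \<nu>_pos inj_X measurable_X _ f_nonneg s1]) measurable
  also have "(\<lambda>x. \<bar>exp (s * f x) - 1\<bar>) = (\<lambda>x. s * (cluster_mgf \<theta> B x - 1))"
  proof
    fix x
    show "\<bar>exp (s * f x) - 1\<bar> = s * (cluster_mgf \<theta> B x - 1)"
      using cluster_mgf_sign[OF B int s, of x] s1 unfolding exp_f by auto
  qed
  finally show ?thesis .
qed

text \<open>With the integrals exchanged, the cluster shape \<open>c\<close> is fixed while its
  position \<open>x\<close> ranges over the whole space; this is the integral that volumes of
  concentric balls bound.\<close>

definition overlap :: "real \<Rightarrow> 'a set \<Rightarrow> 'a multiset \<Rightarrow> ennreal" where
  "overlap \<theta> B c = (\<integral>\<^sup>+x. ennreal (sgn \<theta> * (exp (\<theta> * count_at B x c) - 1)) \<partial>lborel)"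

lemma mgf_total_overlap:
  assumes B: "B \<in> sets borel" and int: "integrable Q (\<lambda>c. exp (\<theta> * real (size c)))" and \<theta>: "\<theta> \<noteq> 0"
  shows "(\<integral>\<^sup>+\<omega>. exp_ennreal \<theta> (total B \<omega>) \<partial>M) =
    exp_ennreal (sgn \<theta>) (ennreal \<nu> * (\<integral>\<^sup>+c. overlap \<theta> B c \<partial>Q))"
proof -
  interpret Q: prob_space Q by (rule prob_space_Q)
  interpret pair_sigma_finite lborel Q ..
  let ?g = "\<lambda>x c. ennreal (sgn \<theta> * (exp (\<theta> * count_at B x c) - 1))"
  have "(\<lambda>(x, c). count_at B x c) \<in> borel_measurable (lborel \<Otimes>\<^sub>M Q)"
    using measurable_compose[OF measurable_pair_swap' measurable_count_at[OF B]]
    by (simp add: split_beta' measurable_cong_sets[OF sets_pair_measure_cong[OF sets_lborel sets_Q] refl])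
  then have g: "case_prod ?g \<in> borel_measurable (lborel \<Otimes>\<^sub>M Q)"
    by (simp add: split_beta')
  then have g': "(\<lambda>x. \<integral>\<^sup>+c. ?g x c \<partial>Q) \<in> borel_measurable lborel"
    by (rule Q.borel_measurable_nn_integral)
  have "(\<integral>\<^sup>+x. ennreal (\<nu> * (sgn \<theta> * (cluster_mgf \<theta> B x - 1))) \<partial>lborel) =
      (\<integral>\<^sup>+x. ennreal \<nu> * (\<integral>\<^sup>+c. ?g x c \<partial>Q) \<partial>lborel)"
    using \<nu>_pos cluster_mgf_sign[OF B int refl]
    by (simp add: ennreal_mult ennreal_cluster_mgf_minus_1[OF B int refl])
  also have "\<dots> = ennreal \<nu> * (\<integral>\<^sup>+x. \<integral>\<^sup>+c. ?g x c \<partial>Q \<partial>lborel)"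
    by (rule nn_integral_cmult[OF g'])
  also have "(\<integral>\<^sup>+x. \<integral>\<^sup>+c. ?g x c \<partial>Q \<partial>lborel) = (\<integral>\<^sup>+c. overlap \<theta> B c \<partial>Q)"
    unfolding overlap_def by (rule Fubini'[OF g, symmetric])
  finally show ?thesis
    by (simp add: mgf_total[OF B int \<theta> refl])
qed

end

section \<open>Asymptotics for large balls\<close>

lemma emeasure_ball_max:
  "emeasure lborel (ball (0::'a::euclidean_space) t) = ennreal (unit_ball_vol (real DIM('a)) * max 0 t ^ DIM('a))"
proof (cases "t \<ge> 0")
  case True
  then show ?thesis by (simp add: emeasure_ball)
next
  case False
  then have "ball (0::'a) t = {}" by (simp add: ball_empty)
  then show ?thesis using False by (simp only: emeasure_empty) (simp add: power_0_left)
qed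

text \<open>Reduces a dominating function of the form \<open>(1 + L) ^ d\<close> to
  \<open>L ^ d\<close> and a constant, which the moment hypothesis controls.\<close>

lemma power_add_le_two_power:
  fixes x :: real
  assumes "0 \<le> x"
  shows "(1 + x) ^ n \<le> 2 ^ n * (1 + x ^ n)"
proof -
  have "(1 + x) ^ n \<le> (2 * max 1 x) ^ n"
    using assms by (intro power_mono) auto
  also have "\<dots> = 2 ^ n * max 1 x ^ n" by (rule power_mult_distrib)
  also have "\<dots> \<le> 2 ^ n * (1 + x ^ n)"
    using assms by (intro mult_left_mono) (auto simp: max_def)
  finally show ?thesis .
qed

context poisson_cluster
begin


lemma overlap_upper:
  assumes "c \<noteq> {#}" "0 < r"
  shows "overlap \<theta> (ball 0 r) c \<le>
    ennreal (sgn \<theta> * (exp (\<theta> * real (size c)) - 1) * (unit_ball_vol (real DIM('a)) * (r + cluster_radius c) ^ DIM('a)))"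
proof -
  let ?k = "sgn \<theta> * (exp (\<theta> * real (size c)) - 1)"
  have k: "0 \<le> ?k"
    by (rule sgn_exp_minus_1_nonneg) simp
  have R: "0 \<le> r + cluster_radius c" using assms cluster_radius_nonneg[of c] by simp
  have "overlap \<theta> (ball 0 r) c \<le> (\<integral>\<^sup>+x. ennreal ?k * indicator (ball (0::'a) (r + cluster_radius c)) x \<partial>lborel)"
    unfolding overlap_def
  proof (rule nn_integral_mono)
    fix x :: 'a
    show "ennreal (sgn \<theta> * (exp (\<theta> * count_at (ball 0 r) x c) - 1)) \<le>
        ennreal ?k * indicator (ball 0 (r + cluster_radius c)) x"
    proof (cases "norm x < r + cluster_radius c")
      case True
      then show ?thesis
        using exp_count_bounds(2)[OF refl, where \<theta> = \<theta> and B = "ball 0 r" and x = x and c = c] by (simp add: ennreal_leI)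
    next
      case False
      have "points_in c {y. y + x \<in> ball 0 r} = 0"
        unfolding points_in_eq_0_iff
      proof (intro ballI notI)
        fix y assume y: "y \<in># c" "y \<in> {y. y + x \<in> ball 0 r}"
        have "norm x \<le> norm (y + x) + norm y" by (metis add_diff_cancel_left' norm_triangle_ineq4)
        with y norm_le_cluster_radius[OF y(1)] False show False by simp
      qed
      then show ?thesis by simp
    qed
  qed
  also have "\<dots> = ennreal ?k * emeasure lborel (ball (0::'a) (r + cluster_radius c))"
    by (rule nn_integral_cmult_indicator) simp
  also have "\<dots> = ennreal (?k * (unit_ball_vol (real DIM('a)) * (r + cluster_radius c) ^ DIM('a)))"
    using k R by (simp add: emeasure_ball ennreal_mult)
  finally show ?thesis .
qed

lemma overlap_lower:
  "ennreal (sgn \<theta> * (exp (\<theta> * real (size c)) - 1) * (unit_ball_vol (real DIM('a)) * max 0 (r - cluster_radius c) ^ DIM('a)))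
    \<le> overlap \<theta> (ball 0 r) c"
proof -
  let ?k = "sgn \<theta> * (exp (\<theta> * real (size c)) - 1)"
  have k: "0 \<le> ?k"
    by (rule sgn_exp_minus_1_nonneg) simp
  have "ennreal (?k * (unit_ball_vol (real DIM('a)) * max 0 (r - cluster_radius c) ^ DIM('a))) =
      ennreal ?k * emeasure lborel (ball (0::'a) (r - cluster_radius c))"
    using k by (simp add: emeasure_ball_max ennreal_mult)
  also have "\<dots> = (\<integral>\<^sup>+x. ennreal ?k * indicator (ball (0::'a) (r - cluster_radius c)) x \<partial>lborel)"
    by (rule nn_integral_cmult_indicator[symmetric]) simp
  also have "\<dots> \<le> overlap \<theta> (ball 0 r) c"
    unfolding overlap_def
  proof (rule nn_integral_mono)
    fix x :: 'a
    show "ennreal ?k * indicator (ball 0 (r - cluster_radius c)) x \<le>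
        ennreal (sgn \<theta> * (exp (\<theta> * count_at (ball 0 r) x c) - 1))"
    proof (cases "norm x < r - cluster_radius c")
      case True
      have "set_mset c \<subseteq> {y. y + x \<in> ball 0 r}"
      proof
        fix y assume y: "y \<in># c"
        have "norm (y + x) \<le> norm y + norm x" by (rule norm_triangle_ineq)
        with norm_le_cluster_radius[OF y] True show "y \<in> {y. y + x \<in> ball 0 r}" by simp
      qed
      then show ?thesis by (simp add: points_in_eq_size indicator_def)
    next
      case False
      then show ?thesis by simp
    qed
  qed
  finally show ?thesis .
qed

definition tail_integrable :: "real \<Rightarrow> bool" where
  "tail_integrable \<theta> \<longleftrightarrow> integrable Q (\<lambda>c. exp (\<theta> * real (size c))) \<and>
     integrable Q (\<lambda>c. cluster_radius c ^ DIM('a) * exp (\<theta> * real (size c)))"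

text \<open>\<open>W\<close> is real-valued for every r > 0, not only for large \<open>r\<close>,
  because exponential integrability is needed at each radius. The exponent 0 enters since
  \<open>\<bar>exp (\<theta> * S) - 1\<bar>\<close> is bounded by
  \<open>exp (\<theta> * S) + 1\<close>, which brings in the plain moment of the radius.\<close>

lemma overlap_limit:
  assumes \<theta>: "\<theta> \<noteq> 0" and int: "tail_integrable \<theta>" "tail_integrable 0"
  shows "\<exists>W. ((\<lambda>r. W r / (unit_ball_vol (real DIM('a)) * r ^ DIM('a))) \<longlongrightarrow> sgn \<theta> * (exp_moment \<theta> - 1)) at_top \<and>
    (\<forall>r>0. 0 \<le> W r \<and> (\<integral>\<^sup>+c. overlap \<theta> (ball 0 r) c \<partial>Q) = ennreal (W r))"
proof -
  interpret Q: prob_space Q by (rule prob_space_Q)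
  let ?v = "unit_ball_vol (real DIM('a))"
  let ?k = "\<lambda>c. sgn \<theta> * (exp (\<theta> * real (size c)) - 1)"
  let ?L = "cluster_radius :: 'a multiset \<Rightarrow> real"
  let ?u = "\<lambda>r c. ?k c * ((r + ?L c) / r) ^ DIM('a)" and ?l = "\<lambda>r c. ?k c * (max 0 (r - ?L c) / r) ^ DIM('a)"
  have v: "?v > 0" by simp
  have meas [measurable]: "?L \<in> borel_measurable Q" "(\<lambda>c. real (size c)) \<in> borel_measurable Q"
    by measurable
  have k: "0 \<le> ?k c" for c
    by (rule sgn_exp_minus_1_nonneg) simp
  have L: "AE c in Q. 0 \<le> ?L c"
    using AE_size_pos by eventually_elim (auto intro!: cluster_radius_nonneg)
  \<comment> \<open>A common dominating function: for r \<ge> 1 both \<open>(r + L) / r\<close> and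
    \<open>max 0 (r - L) / r\<close> are at most \<open>1 + L\<close>.\<close>
  define w where "w c = ?k c * (1 + ?L c) ^ DIM('a)" for c
  have w: "integrable Q w"
  proof (rule Bochner_Integration.integrable_bound)
    show "integrable Q (\<lambda>c. (exp (\<theta> * real (size c)) + 1) * (2 ^ DIM('a) * (1 + ?L c ^ DIM('a))))"
    proof -
      have "integrable Q (\<lambda>c. 2 ^ DIM('a) * (exp (\<theta> * real (size c)) + 1 + ?L c ^ DIM('a) * exp (\<theta> * real (size c)) + ?L c ^ DIM('a)))"
        using int by (simp add: tail_integrable_def)
      then show ?thesis by (simp add: algebra_simps)
    qed
    show "AE c in Q. norm (w c) \<le> norm ((exp (\<theta> * real (size c)) + 1) * (2 ^ DIM('a) * (1 + ?L c ^ DIM('a))))"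
      using L
    proof eventually_elim
      case (elim c)
      have "w c \<le> (exp (\<theta> * real (size c)) + 1) * (2 ^ DIM('a) * (1 + ?L c ^ DIM('a)))"
        unfolding w_def
      proof (intro mult_mono power_add_le_two_power[OF elim])
        show "?k c \<le> exp (\<theta> * real (size c)) + 1"
          using exp_ge_zero[of "\<theta> * real (size c)"] by (simp add: sgn_if)
      qed (use elim k in auto)
      moreover have "0 \<le> w c" using k[of c] elim by (simp add: w_def)
      ultimately show ?case by simp
    qed
    show "w \<in> borel_measurable Q" unfolding w_def by measurable
  qed
  have bound_u: "AE c in Q. norm (?u r c) \<le> w c" if "1 \<le> r" for r
    using L
  proof eventually_elim
    case (elim c)
    have "(r + ?L c) / r \<le> 1 + ?L c"
      using that elim mult_left_mono[OF that elim] by (simp add: field_simps)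
    then have "((r + ?L c) / r) ^ DIM('a) \<le> (1 + ?L c) ^ DIM('a)"
      using that elim by (intro power_mono) auto
    then have "?k c * ((r + ?L c) / r) ^ DIM('a) \<le> w c"
      unfolding w_def using k[of c] by (rule mult_left_mono)
    moreover have "0 \<le> ?k c * ((r + ?L c) / r) ^ DIM('a)"
      using that elim by (intro mult_nonneg_nonneg[OF k[of c]]) auto
    ultimately show ?case by (simp only: real_norm_def abs_of_nonneg)
  qed
  have bound_l: "AE c in Q. norm (?l r c) \<le> w c" if "1 \<le> r" for r
    using L
  proof eventually_elim
    case (elim c)
    have "max 0 (r - ?L c) / r \<le> 1 + ?L c"
      using that elim mult_left_mono[OF that elim] by (simp add: field_simps max_def)
    then have "(max 0 (r - ?L c) / r) ^ DIM('a) \<le> (1 + ?L c) ^ DIM('a)"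
      using that elim by (intro power_mono) auto
    then have "?k c * (max 0 (r - ?L c) / r) ^ DIM('a) \<le> w c"
      unfolding w_def using k[of c] by (rule mult_left_mono)
    moreover have "0 \<le> ?k c * (max 0 (r - ?L c) / r) ^ DIM('a)"
      using that elim by (intro mult_nonneg_nonneg[OF k[of c]]) auto
    ultimately show ?case by (simp only: real_norm_def abs_of_nonneg)
  qed
  have "((\<lambda>r. ?u r c) \<longlongrightarrow> ?k c * 1 ^ DIM('a)) at_top" for c
  proof (intro tendsto_intros)
    show "((\<lambda>r. (r + ?L c) / r) \<longlongrightarrow> 1) at_top" by real_asymp
  qed
  then have lim_u: "((\<lambda>r. \<integral>c. ?u r c \<partial>Q) \<longlongrightarrow> (\<integral>c. ?k c \<partial>Q)) at_top"
    by (intro integral_dominated_convergence_at_top[where w = w] w AE_I2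
        eventually_mono[OF eventually_ge_at_top[of 1] bound_u]) auto
  have "((\<lambda>r. ?l r c) \<longlongrightarrow> ?k c * 1 ^ DIM('a)) at_top" for c
  proof (intro tendsto_intros)
    show "((\<lambda>r. max 0 (r - ?L c) / r) \<longlongrightarrow> 1) at_top"
    proof (rule Lim_transform_eventually)
      show "((\<lambda>r. (r - ?L c) / r) \<longlongrightarrow> 1) at_top" by real_asymp
      show "eventually (\<lambda>r. (r - ?L c) / r = max 0 (r - ?L c) / r) at_top"
        using eventually_ge_at_top[of "?L c"] by eventually_elim simp
    qed
  qed
  then have lim_l: "((\<lambda>r. \<integral>c. ?l r c \<partial>Q) \<longlongrightarrow> (\<integral>c. ?k c \<partial>Q)) at_top"
    by (intro integral_dominated_convergence_at_top[where w = w] w AE_I2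
        eventually_mono[OF eventually_ge_at_top[of 1] bound_l]) auto
  have k_int: "(\<integral>c. ?k c \<partial>Q) = sgn \<theta> * (exp_moment \<theta> - 1)"
    using int by (simp add: exp_moment_def tail_integrable_def Q.prob_space)
  define W where "W r = enn2real (\<integral>\<^sup>+c. overlap \<theta> (ball 0 r) c \<partial>Q)" for r
  \<comment> \<open>Below r = 1 the bound by \<open>w\<close> may fail; a factor depending on
    \<open>r\<close> repairs it and gives finiteness at every radius.\<close>
  have u_int: "integrable Q (?u r)" if r: "0 < r" for r
  proof (rule Bochner_Integration.integrable_bound)
    show "integrable Q (\<lambda>c. (1 + 1 / r) ^ DIM('a) * w c)" using w by simp
    show "AE c in Q. norm (?u r c) \<le> norm ((1 + 1 / r) ^ DIM('a) * w c)"
      using L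
    proof eventually_elim
      case (elim c)
      have "(r + ?L c) / r \<le> (1 + 1 / r) * (1 + ?L c)"
        using r elim by (simp add: field_simps)
      then have "((r + ?L c) / r) ^ DIM('a) \<le> ((1 + 1 / r) * (1 + ?L c)) ^ DIM('a)"
        using r elim by (intro power_mono) auto
      then have "?u r c \<le> ?k c * ((1 + 1 / r) * (1 + ?L c)) ^ DIM('a)"
        using k[of c] by (rule mult_left_mono)
      also have "\<dots> = (1 + 1 / r) ^ DIM('a) * w c"
        by (simp add: w_def power_mult_distrib)
      finally show ?case using k[of c] r elim by simp
    qed
  qed measurable
  have upper: "(\<integral>\<^sup>+c. overlap \<theta> (ball 0 r) c \<partial>Q) \<le> ennreal (?v * r ^ DIM('a) * (\<integral>c. ?u r c \<partial>Q))"
    if r: "0 < r" for r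
  proof -
    have "(\<integral>\<^sup>+c. overlap \<theta> (ball 0 r) c \<partial>Q) \<le> (\<integral>\<^sup>+c. ennreal (?v * r ^ DIM('a) * ?u r c) \<partial>Q)"
    proof (rule nn_integral_mono_AE, use AE_size_pos in eventually_elim)
      case (elim c)
      then have "c \<noteq> {#}" by auto
      from overlap_upper[OF this r, of \<theta>]
      show ?case using r by (simp add: power_divide mult_ac)
    qed
    also have "\<dots> = ennreal (\<integral>c. ?v * r ^ DIM('a) * ?u r c \<partial>Q)"
    proof (rule nn_integral_eq_integral)
      show "integrable Q (\<lambda>c. ?v * r ^ DIM('a) * ?u r c)" using u_int[OF r] by simp
      show "AE c in Q. 0 \<le> ?v * r ^ DIM('a) * ?u r c"
        using L
      proof eventually_elim
        case (elim c)
        then show ?case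
          using r by (intro mult_nonneg_nonneg[OF _ mult_nonneg_nonneg[OF k]]) auto
      qed
    qed
    finally show ?thesis by simp
  qed
  have lower: "ennreal (?v * r ^ DIM('a) * (\<integral>c. ?l r c \<partial>Q)) \<le> (\<integral>\<^sup>+c. overlap \<theta> (ball 0 r) c \<partial>Q)"
    if r: "1 \<le> r" for r
  proof -
    have "integrable Q (?l r)"
      by (rule Bochner_Integration.integrable_bound[OF w])
         (use bound_l[OF r] in \<open>auto elim!: eventually_mono\<close>)
    then have l_int: "integrable Q (\<lambda>c. ?v * r ^ DIM('a) * ?l r c)" by (rule integrable_mult_right)
    have l_pos: "0 \<le> ?v * r ^ DIM('a) * ?l r c" for c
      using r by (intro mult_nonneg_nonneg[OF _ mult_nonneg_nonneg[OF k]]) auto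
    have "ennreal (?v * r ^ DIM('a) * (\<integral>c. ?l r c \<partial>Q)) = ennreal (\<integral>c. ?v * r ^ DIM('a) * ?l r c \<partial>Q)"
      by (simp only: integral_mult_right_zero)
    also have "\<dots> = (\<integral>\<^sup>+c. ennreal (?v * r ^ DIM('a) * ?l r c) \<partial>Q)"
      by (rule nn_integral_eq_integral[OF l_int AE_I2[OF l_pos], symmetric])
    also have "\<dots> \<le> (\<integral>\<^sup>+c. overlap \<theta> (ball 0 r) c \<partial>Q)"
    proof (rule nn_integral_mono)
      fix c
      have "?v * r ^ DIM('a) * ?l r c = ?k c * (?v * max 0 (r - ?L c) ^ DIM('a))"
        using r by (simp add: power_divide)
      then show "ennreal (?v * r ^ DIM('a) * ?l r c) \<le> overlap \<theta> (ball 0 r) c"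
        using overlap_lower[of \<theta> c r] by (simp only:)
    qed
    finally show ?thesis .
  qed
  have W: "(\<integral>\<^sup>+c. overlap \<theta> (ball 0 r) c \<partial>Q) = ennreal (W r)" if "0 < r" for r
    unfolding W_def
    by (rule ennreal_enn2real[symmetric], rule le_less_trans[OF upper[OF that]]) simp
  have vr: "0 < ?v * r ^ DIM('a)" if "0 < r" for r :: real using that v by simp
  have "((\<lambda>r. W r / (?v * r ^ DIM('a))) \<longlongrightarrow> sgn \<theta> * (exp_moment \<theta> - 1)) at_top"
  proof (rule tendsto_sandwich)
    show "((\<lambda>r. \<integral>c. ?l r c \<partial>Q) \<longlongrightarrow> sgn \<theta> * (exp_moment \<theta> - 1)) at_top"
      using lim_l by (simp only: k_int)
    show "((\<lambda>r. \<integral>c. ?u r c \<partial>Q) \<longlongrightarrow> sgn \<theta> * (exp_moment \<theta> - 1)) at_top"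
      using lim_u by (simp only: k_int)
    show "eventually (\<lambda>r. (\<integral>c. ?l r c \<partial>Q) \<le> W r / (?v * r ^ DIM('a))) at_top"
      using eventually_ge_at_top[of 1]
    proof eventually_elim
      case (elim r)
      have "0 \<le> W r" by (simp add: W_def)
      then have "?v * r ^ DIM('a) * (\<integral>c. ?l r c \<partial>Q) \<le> W r"
        using lower[OF elim] W[of r] elim by (simp add: ennreal_le_iff)
      then show ?case
        using vr[of r] elim by (simp add: pos_le_divide_eq mult.commute)
    qed
    show "eventually (\<lambda>r. W r / (?v * r ^ DIM('a)) \<le> (\<integral>c. ?u r c \<partial>Q)) at_top"
      using eventually_ge_at_top[of 1]
    proof eventually_elim
      case (elim r)
      have "0 \<le> (\<integral>c. ?u r c \<partial>Q)"
      proof (rule integral_nonneg_AE, use L in eventually_elim)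
        case (elim c)
        with \<open>1 \<le> r\<close> show ?case by (intro mult_nonneg_nonneg[OF k]) auto
      qed
      then have "0 \<le> ?v * r ^ DIM('a) * (\<integral>c. ?u r c \<partial>Q)"
        using vr[of r] elim by (intro mult_nonneg_nonneg) auto
      then have "W r \<le> ?v * r ^ DIM('a) * (\<integral>c. ?u r c \<partial>Q)"
        using upper[of r] W[of r] elim by (simp add: ennreal_le_iff)
      then show ?case
        using vr[of r] elim by (simp add: pos_divide_le_eq mult.commute)
    qed
  qed
  then show ?thesis using W by (intro exI[of _ W]) (auto simp: W_def)
qed

end

section \<open>The cumulant and its Legendre transform\<close>

text \<open>If each end is beaten by some point, the minimum is interior. Applied to
  \<open>cumulant t - y * t\<close> this realises the slope \<open>y\<close> without continuity of
  the derivative.\<close>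

lemma interior_critical_point:
  fixes f f' :: "real \<Rightarrow> real"
  assumes deriv: "\<And>t. t \<in> {a..c} \<Longrightarrow> (f has_real_derivative f' t) (at t)"
    and p: "p \<in> {a..c}" "f p < f a" and q: "q \<in> {a..c}" "f q < f c"
  obtains t where "a < t" "t < c" "f' t = 0"
proof -
  have "continuous_on {a..c} f"
    by (intro continuous_at_imp_continuous_on ballI DERIV_isCont[OF deriv])
  then obtain t where t: "t \<in> {a..c}" "\<And>y. y \<in> {a..c} \<Longrightarrow> f t \<le> f y"
    using p continuous_attains_inf[of "{a..c}" f] by auto
  have "t \<noteq> a" "t \<noteq> c" using t(2)[OF p(1)] t(2)[OF q(1)] p(2) q(2) by auto
  with t(1) have *: "a < t" "t < c" by auto
  have "f' t = 0"
  proof (rule DERIV_local_min[OF deriv[OF t(1)]])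
    show "0 < min (t - a) (c - t)" using * by simp
    show "\<forall>y. \<bar>t - y\<bar> < min (t - a) (c - t) \<longrightarrow> f t \<le> f y" using t(2) by (auto simp: abs_if split: if_splits)
  qed
  with * that show ?thesis by blast
qed

lemma ball_volume_eq: "ball_volume d r = unit_ball_vol (real d) * r ^ d"
  by (simp add: ball_volume_def unit_ball_vol_def add.commute mult.commute)

lemma is_speed_ball_volume:
  assumes "0 < d"
  shows "is_speed (ball_volume d)"
proof -
  have "filterlim (\<lambda>r::real. r ^ d) at_top at_top"
    using assms by (intro filterlim_pow_at_top filterlim_ident)
  then have "filterlim (\<lambda>r. unit_ball_vol (real d) * r ^ d) at_top at_top"
    by (intro filterlim_tendsto_pos_mult_at_top[OF tendsto_const]) auto
  moreover have "mono_on {0..} (\<lambda>r. unit_ball_vol (real d) * r ^ d)"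
    by (auto intro!: mono_onI mult_left_mono power_mono)
  moreover have "(\<lambda>r. unit_ball_vol (real d) * r ^ d) \<in> borel_measurable (restrict_space borel {0..})"
    by (intro measurable_restrict_space1) measurable
  ultimately show ?thesis
    unfolding is_speed_def ball_volume_eq[abs_def] by auto
qed

section \<open>The cumulant on its domain and its attainable slopes\<close>

context poisson_cluster
begin

text \<open>Where the exponential moment is infinite the Bochner integral is 0 by default and this
  value is -\<nu>; only values on the domain carry meaning.\<close>

definition cumulant :: "real \<Rightarrow> real" where
  "cumulant \<theta> = \<nu> * (exp_moment \<theta> - 1)"

abbreviation exp_integrable :: "real \<Rightarrow> bool" where
  "exp_integrable \<theta> \<equiv> integrable Q (\<lambda>c. exp (\<theta> * real (size c)))"

lemma size_mgf_eq: "exp_integrable \<theta> \<Longrightarrow> size_mgf Q \<theta> = ereal (exp_moment \<theta>)"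
  unfolding size_mgf_def exp_moment_def
  by (subst nn_integral_eq_integral) (auto simp: enn2ereal_ennreal integral_nonneg_AE)

lemma size_mgf_finite_iff: "size_mgf Q \<theta> < \<infinity> \<longleftrightarrow> exp_integrable \<theta>"
proof
  assume "size_mgf Q \<theta> < \<infinity>"
  then have "(\<integral>\<^sup>+c. ennreal (exp (\<theta> * real (size c))) \<partial>Q) < \<infinity>"
    unfolding infinity_ennreal_def by (simp add: size_mgf_def top.not_eq_extremum[symmetric] enn2ereal_eq_top_iff)
  then show "exp_integrable \<theta>" by (intro integrableI_nonneg) auto
qed (simp add: size_mgf_eq)

lemma size_mgf_domain_eq: "size_mgf_domain Q = {\<theta>. exp_integrable \<theta>}"
  by (simp only: size_mgf_domain_def size_mgf_finite_iff)

lemma cluster_cumulant_eq: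
  "cluster_cumulant \<nu> Q \<theta> = (if exp_integrable \<theta> then ereal (cumulant \<theta>) else \<infinity>)"
proof (cases "exp_integrable \<theta>")
  case True
  then show ?thesis by (simp add: cluster_cumulant_def cumulant_def size_mgf_eq one_ereal_def)
next
  case False
  then have "size_mgf Q \<theta> = \<infinity>" using size_mgf_finite_iff[of \<theta>] by auto
  then show ?thesis using False \<nu>_pos by (simp add: cluster_cumulant_def one_ereal_def)
qed

lemma exp_integrable_mono:
  assumes "\<theta> \<le> \<theta>'" "exp_integrable \<theta>'"
  shows "exp_integrable \<theta>"
  by (rule Bochner_Integration.integrable_bound[OF assms(2)])
     (use assms(1) in \<open>auto intro!: AE_I2 mult_right_mono\<close>)

lemma exp_moment_mono:
  assumes "\<theta> \<le> \<theta>'" "exp_integrable \<theta>'"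
  shows "exp_moment \<theta> \<le> exp_moment \<theta>'"
  unfolding exp_moment_def
  by (intro integral_mono exp_integrable_mono[OF assms] assms(2))
     (use assms(1) in \<open>auto intro!: AE_I2 mult_right_mono\<close>)

lemma exp_moment_0 [simp]: "exp_moment 0 = 1" and cumulant_0 [simp]: "cumulant 0 = 0"
proof -
  interpret Q: prob_space Q by (rule prob_space_Q)
  show "exp_moment 0 = 1" by (simp add: exp_moment_def Q.prob_space)
  then show "cumulant 0 = 0" by (simp add: cumulant_def)
qed

lemma exp_integrable_0: "exp_integrable 0"
proof -
  interpret Q: prob_space Q by (rule prob_space_Q)
  show ?thesis by simp
qed

lemma exp_moment_nonneg: "0 \<le> exp_moment \<theta>"
  unfolding exp_moment_def by (intro integral_nonneg_AE) auto

lemma cumulant_mono: "\<theta> \<le> \<theta>' \<Longrightarrow> exp_integrable \<theta>' \<Longrightarrow> cumulant \<theta> \<le> cumulant \<theta>'"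
  using exp_moment_mono \<nu>_pos by (simp add: cumulant_def)

lemma cumulant_ge: "- \<nu> \<le> cumulant \<theta>"
  using mult_nonneg_nonneg[OF less_imp_le[OF \<nu>_pos] exp_moment_nonneg[of \<theta>]]
  by (simp add: cumulant_def algebra_simps)

text \<open>Follows from S \<ge> 1; it makes the cumulant outrun every linear function when the
  domain is the whole line.\<close>

lemma exp_moment_ge:
  assumes "0 \<le> \<theta>" "exp_integrable \<theta>"
  shows "exp \<theta> \<le> exp_moment \<theta>"
proof -
  interpret Q: prob_space Q by (rule prob_space_Q)
  have "(\<integral>c. exp \<theta> \<partial>Q) \<le> exp_moment \<theta>"
    unfolding exp_moment_def
  proof (rule integral_mono_AE)
    show "AE c in Q. exp \<theta> \<le> exp (\<theta> * real (size c))"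
      using AE_size_pos
    proof eventually_elim
      case (elim c)
      then show ?case using mult_left_mono[of 1 "real (size c)" \<theta>] assms(1) by simp
    qed
  qed (use assms in auto)
  then show ?thesis by (simp add: Q.prob_space)
qed

text \<open>Nonempty clusters make the cumulant strictly negative at -1, which provides the
  comparison point for the rate at 0.\<close>

lemma exp_moment_minus_1: "exp_moment (- 1) < 1"
proof -
  interpret Q: prob_space Q by (rule prob_space_Q)
  have "exp_moment (- 1) \<le> (\<integral>c. exp (- 1) \<partial>Q)"
    unfolding exp_moment_def
  proof (rule integral_mono_AE)
    show "AE c in Q. exp (- 1 * real (size c)) \<le> exp (- 1)"
      using AE_size_pos by eventually_elim simp
  qed (use exp_integrable_mono[OF _ exp_integrable_0, of "- 1"] in auto)
  also have "\<dots> < 1" by (simp add: Q.prob_space)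
  finally show ?thesis .
qed

text \<open>Integrates \<open>1 + u \<le> exp u\<close>. The slope \<open>\<nu> * E[S]\<close>
  becomes the point \<open>m\<close> at which the upper bound cuts the line.\<close>

lemma cumulant_tangent_0:
  assumes "(\<integral>\<^sup>+c. of_nat (size c) \<partial>Q) < \<infinity>" "exp_integrable \<theta>"
  shows "\<theta> * (\<nu> * (\<integral>c. real (size c) \<partial>Q)) \<le> cumulant \<theta>"
proof -
  interpret Q: prob_space Q by (rule prob_space_Q)
  have int: "integrable Q (\<lambda>c. real (size c))"
    using assms(1) by (intro integrableI_nonneg) (auto simp: ennreal_of_nat_eq_real_of_nat)
  have "(\<integral>c. \<theta> * real (size c) \<partial>Q) \<le> (\<integral>c. exp (\<theta> * real (size c)) - 1 \<partial>Q)"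
  proof (rule integral_mono)
    fix c
    show "\<theta> * real (size c) \<le> exp (\<theta> * real (size c)) - 1"
      using exp_ge_add_one_self[of "\<theta> * real (size c)"] by linarith
  qed (use int assms(2) in auto)
  also have "\<dots> = exp_moment \<theta> - 1"
    using assms(2) by (simp add: exp_moment_def Q.prob_space)
  finally have "\<nu> * (\<theta> * (\<integral>c. real (size c) \<partial>Q)) \<le> cumulant \<theta>"
    unfolding cumulant_def using int \<nu>_pos by (intro mult_left_mono) auto
  then show ?thesis by (simp add: mult_ac)
qed

lemma interior_domain_down_closed:
  assumes "\<theta> \<in> interior (size_mgf_domain Q)" "\<theta>' \<le> \<theta>"
  shows "\<theta>' \<in> interior (size_mgf_domain Q)"
proof (cases "\<theta>' = \<theta>")
  case False
  have "exp_integrable \<theta>" using assms(1) interior_subset size_mgf_domain_eq by blast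
  then have "{..<\<theta>} \<subseteq> size_mgf_domain Q"
    using exp_integrable_mono[of _ \<theta>] by (auto simp: size_mgf_domain_eq)
  then show ?thesis
    using assms False by (intro interiorI[of "{..<\<theta>}"]) auto
qed (use assms in simp)

text \<open>Boundary points of the domain may be ignored: since the cumulant is nondecreasing, moving
  slightly to the left decreases only the linear term, by an arbitrarily small amount.\<close>

lemma legendre_interior:
  "legendre_transform (cluster_cumulant \<nu> Q) x =
    (SUP \<theta>\<in>interior (size_mgf_domain Q). ereal (\<theta> * x - cumulant \<theta>))" (is "_ = ?J")
proof (rule antisym)
  show "?J \<le> legendre_transform (cluster_cumulant \<nu> Q) x"
    unfolding legendre_transform_def
  proof (rule SUP_mono)
    fix \<theta> assume "\<theta> \<in> interior (size_mgf_domain Q)"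
    then have "exp_integrable \<theta>" using interior_subset size_mgf_domain_eq by blast
    then show "\<exists>\<theta>'\<in>UNIV. ereal (\<theta> * x - cumulant \<theta>) \<le> ereal (\<theta>' * x) - cluster_cumulant \<nu> Q \<theta>'"
      by (intro bexI[of _ \<theta>]) (auto simp: cluster_cumulant_eq)
  qed
  show "legendre_transform (cluster_cumulant \<nu> Q) x \<le> ?J"
    unfolding legendre_transform_def
  proof (rule SUP_least)
    fix \<theta> :: real
    show "ereal (\<theta> * x) - cluster_cumulant \<nu> Q \<theta> \<le> ?J"
    proof (cases "exp_integrable \<theta>")
      case True
      have "ereal (\<theta> * x - cumulant \<theta> - e) \<le> ?J" if "0 < e" for e
      proof -
        \<comment> \<open>The shift lowers the linear term by at most \<open>e\<close>; +1 covers x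
          = 0.\<close>
        define \<theta>' where "\<theta>' = \<theta> - e / (\<bar>x\<bar> + 1)"
        have less: "\<theta>' < \<theta>" using that by (simp add: \<theta>'_def)
        have "{..<\<theta>} \<subseteq> size_mgf_domain Q"
          using exp_integrable_mono[OF _ True] by (auto simp: size_mgf_domain_eq)
        then have "\<theta>' \<in> interior (size_mgf_domain Q)"
          using less by (intro interiorI[of "{..<\<theta>}"]) auto
        then have "ereal (\<theta>' * x - cumulant \<theta>') \<le> ?J" by (rule SUP_upper)
        moreover have "\<theta> * x - cumulant \<theta> - e \<le> \<theta>' * x - cumulant \<theta>'"
        proof -
          have "e / (\<bar>x\<bar> + 1) * x \<le> e / (\<bar>x\<bar> + 1) * (\<bar>x\<bar> + 1)"
            using that by (intro mult_left_mono) auto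
          then have "e / (\<bar>x\<bar> + 1) * x \<le> e" by simp
          moreover have "cumulant \<theta>' \<le> cumulant \<theta>" using cumulant_mono[OF _ True] less by simp
          ultimately show ?thesis by (simp add: \<theta>'_def left_diff_distrib)
        qed
        ultimately show ?thesis by (meson ereal_less_eq(3) order_trans)
      qed
      then have "ereal (\<theta> * x - cumulant \<theta>) \<le> ?J" by (rule ereal_le_minus_epsilon)
      then show ?thesis using True by (simp add: cluster_cumulant_eq)
    next
      case False
      then show ?thesis by (simp add: cluster_cumulant_eq)
    qed
  qed
qed

text \<open>Positive \<open>x\<close> are attained exactly as derivatives. Slope 0 is approached
  only as the exponent tends to minus infinity, so small positive slopes at negative exponents
  replace it. Negative \<open>x\<close> have infinite rate, contradicting finiteness.\<close>

lemma exposed_points: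
  assumes smooth: "essentially_smooth (size_mgf Q)" and zero: "0 \<in> interior (size_mgf_domain Q)"
    and finite: "(SUP \<theta>\<in>interior (size_mgf_domain Q). ereal (\<theta> * x - cumulant \<theta>)) < \<infinity>" and e: "0 < e"
  shows "\<exists>\<theta>\<in>interior (size_mgf_domain Q). \<exists>y. (cumulant has_real_derivative y) (at \<theta>) \<and> \<bar>y - x\<bar> < e \<and>
    ereal (\<theta> * y - cumulant \<theta>) \<le> (SUP \<theta>\<in>interior (size_mgf_domain Q). ereal (\<theta> * x - cumulant \<theta>))"
proof -
  let ?D = "interior (size_mgf_domain Q)" and ?g = "\<lambda>\<theta>. real_of_ereal (size_mgf Q \<theta>)"
  have D: "exp_integrable \<theta>" if "\<theta> \<in> ?D" for \<theta>
    using that interior_subset size_mgf_domain_eq by blast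
  note down = interior_domain_down_closed
  have neg_D: "\<theta> \<in> ?D" if "\<theta> \<le> 0" for \<theta> by (rule down[OF zero that])
  have U: "interior {x. size_mgf Q x < \<infinity>} = ?D" by (simp add: size_mgf_domain_def)
  have g_diff: "?g differentiable (at \<theta>)" if "\<theta> \<in> ?D" for \<theta>
    using smooth that by (simp only: essentially_smooth_def Let_def U)
  have blowup: "filterlim (\<lambda>n. \<bar>deriv ?g (t n)\<bar>) at_top sequentially"
    if "\<And>n. t n \<in> ?D" "b \<in> frontier ?D" "t \<longlonglongrightarrow> b" for t :: "nat \<Rightarrow> real" and b
    using smooth that by (simp only: essentially_smooth_def Let_def U) blast
  have der: "(exp_moment has_real_derivative deriv ?g \<theta>) (at \<theta>)" if \<theta>: "\<theta> \<in> ?D" for \<theta>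
  proof (rule has_field_derivative_transform_within_open[OF _ open_interior \<theta>])
    show "(?g has_real_derivative deriv ?g \<theta>) (at \<theta>)"
      using g_diff[OF \<theta>] by (simp add: DERIV_deriv_iff_real_differentiable)
  qed (simp add: size_mgf_eq D)
  have der_cum: "(cumulant has_real_derivative \<nu> * deriv ?g \<theta>) (at \<theta>)" if "\<theta> \<in> ?D" for \<theta>
    unfolding cumulant_def[abs_def] using der[OF that] by (auto intro!: derivative_eq_intros)
  have der_phi: "((\<lambda>t. cumulant t - y * t) has_real_derivative \<nu> * deriv ?g \<theta> - y) (at \<theta>)" if "\<theta> \<in> ?D" for \<theta> y
    using der_cum[OF that] by (auto intro!: derivative_eq_intros)
  \<comment> \<open>Since the cumulant is at least -\<nu>, at this \<open>a\<close> the function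
    \<open>cumulant t - y * t\<close> is at least \<open>y\<close>, above its value 0 at the origin;
    so the left end is no minimiser.\<close>
  have left: "0 < cumulant a - y * a" if "0 < y" "a = - (\<nu> / y) - 1" for a y
  proof -
    have "y * a = - \<nu> - y" using that by (simp add: field_simps)
    then show ?thesis using cumulant_ge[of a] that(1) by linarith
  qed
  consider "0 < x" | "x = 0" | "x < 0" by linarith
  then show ?thesis
  proof cases
    case 1
    define a where "a = - (\<nu> / x) - 1"
    have a: "a < 0" "0 < cumulant a - x * a"
      using divide_pos_pos[OF \<nu>_pos 1] left[OF 1] by (auto simp: a_def)
    \<comment> \<open>A right end that is no minimiser either. If the domain is the whole line,
      exponential growth provides it; otherwise essential smoothness makes the derivative exceed the
      target slope near the right boundary.\<close>
    have "\<exists>c\<in>?D. 0 < c \<and> (\<exists>q\<in>{0..c}. cumulant q - x * q < cumulant c - x * c)"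
    proof (cases "?D = UNIV")
      case True
      have large: "eventually (\<lambda>c. 0 < \<nu> * (exp c - 1) - x * c) at_top"
        using \<nu>_pos by real_asymp
      obtain c where c: "0 < c" "0 < \<nu> * (exp c - 1) - x * c"
        using eventually_happens'[OF _ eventually_conj[OF eventually_gt_at_top[of 0] large]] by auto
      have "\<nu> * (exp c - 1) \<le> cumulant c"
        unfolding cumulant_def using exp_moment_ge[of c] c(1) D[of c] True \<nu>_pos
        by (intro mult_left_mono) auto
      then show ?thesis using c True by (intro bexI[of _ c] conjI bexI[of _ 0]) auto
    next
      case False
      then obtain z where "z \<notin> ?D" by blast
      then have ub: "\<theta> \<le> z" if "\<theta> \<in> ?D" for \<theta> using down[OF that, of z] \<open>z \<notin> ?D\<close> by (cases "z \<le> \<theta>") auto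
      define b where "b = Sup ?D"
      have bdd: "bdd_above ?D" using ub by (rule bdd_aboveI)
      have le_b: "\<theta> \<le> b" if "\<theta> \<in> ?D" for \<theta> unfolding b_def by (rule cSup_upper[OF that bdd])
      have lt_b: "\<theta> \<in> ?D" if less: "\<theta> < b" for \<theta>
      proof -
        obtain \<theta>' where "\<theta>' \<in> ?D" "\<theta> < \<theta>'"
          by (rule less_cSupE[OF less[unfolded b_def]]) (use zero in auto)
        then show ?thesis using down[of \<theta>' \<theta>] by simp
      qed
      have b: "b \<notin> ?D"
      proof
        assume "b \<in> ?D"
        then obtain d where "0 < d" "ball b d \<subseteq> ?D" by (rule openE[OF open_interior])
        then have "b + d / 2 \<in> ?D" by (auto simp: subset_iff dist_real_def)
        with le_b[of "b + d / 2"] \<open>0 < d\<close> show False by simp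
      qed
      have b0: "0 < b" using le_b[OF zero] b zero by (metis order_le_less)
      \<comment> \<open>The +2 keeps every term strictly between 0 and \<open>b\<close>, already for
        n = 0.\<close>
      define t where "t n = b - b / (real n + 2)" for n
      have t: "t n \<in> ?D" "0 < t n" for n
      proof -
        have "b * 1 < b * (real n + 2)" by (rule mult_strict_left_mono) (use b0 in auto)
        then have "b / (real n + 2) < b" by (simp add: pos_divide_less_eq)
        moreover have "0 < b / (real n + 2)" using b0 by simp
        ultimately show "t n \<in> ?D" "0 < t n" by (auto simp: t_def intro: lt_b)
      qed
      have t_lim: "t \<longlonglongrightarrow> b" unfolding t_def by real_asymp
      have "b \<in> closure ?D" using t(1) t_lim closure_sequential by blast
      then have "b \<in> frontier ?D" using b by (simp add: frontier_def)
      from blowup[OF t(1) this t_lim]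
      have "eventually (\<lambda>n. x / \<nu> < \<bar>deriv ?g (t n)\<bar>) sequentially"
        by (simp add: filterlim_at_top_dense)
      then obtain n where n: "x / \<nu> < \<bar>deriv ?g (t n)\<bar>"
        using eventually_happens by fastforce
      \<comment> \<open>Essential smoothness controls only the absolute value of the derivative;
        monotonicity supplies its sign.\<close>
      have "mono_on ?D exp_moment" using exp_moment_mono D by (auto intro: mono_onI)
      then have "0 \<le> deriv ?g (t n)"
        by (rule mono_on_imp_deriv_nonneg[OF _ der[OF t(1)]]) (use t(1) in simp)
      with n have "0 < \<nu> * deriv ?g (t n) - x" using \<nu>_pos by (simp add: field_simps)
      from DERIV_pos_inc_left[OF der_phi[OF t(1)] this]
      obtain d where d: "0 < d" "\<And>h. 0 < h \<Longrightarrow> h < d \<Longrightarrow> cumulant (t n - h) - x * (t n - h) < cumulant (t n) - x * t n"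
        by blast
      \<comment> \<open>The step back must be shorter than \<open>d\<close> and must not pass 0, so
        that the comparison point lies in \<open>{0..c}\<close>.\<close>
      define h where "h = min (d / 2) (t n)"
      have "0 < h" "h < d" "h \<le> t n" using d(1) t(2)[of n] by (auto simp: h_def)
      then show ?thesis
        using d(2)[of h] t[of n] by (intro bexI[of _ "t n"] conjI bexI[of _ "t n - h"]) auto
    qed
    then obtain c q where c: "c \<in> ?D" "0 < c" and q: "q \<in> {0..c}" "cumulant q - x * q < cumulant c - x * c"
      by blast
    obtain \<theta> where \<theta>: "a < \<theta>" "\<theta> < c" "\<nu> * deriv ?g \<theta> - x = 0"
    proof (rule interior_critical_point[of a c "\<lambda>t. cumulant t - x * t" "\<lambda>\<theta>. \<nu> * deriv ?g \<theta> - x" 0 q])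
      show "((\<lambda>t. cumulant t - x * t) has_real_derivative \<nu> * deriv ?g t - x) (at t)" if "t \<in> {a..c}" for t
        using that by (intro der_phi down[OF c(1)]) auto
    qed (use a c q in auto)
    have "\<theta> \<in> ?D" using down[OF c(1)] \<theta>(2) by simp
    moreover have "(cumulant has_real_derivative x) (at \<theta>)"
      using der_cum[OF \<open>\<theta> \<in> ?D\<close>] \<theta>(3) by simp
    ultimately show ?thesis
      using e by (intro bexI[of _ \<theta>] exI[of _ x] conjI SUP_upper) auto
  next
    case 2
    have "cumulant (- 1) < 0" using exp_moment_minus_1 \<nu>_pos by (simp add: cumulant_def mult_pos_neg)
    \<comment> \<open>Below \<open>e\<close> for closeness, and small enough that
      \<open>cumulant t - y * t\<close> is still negative at t = -1, beating its value 0 at the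
      right end t = 0.\<close>
    define y where "y = min e (- cumulant (- 1)) / 2"
    have y: "0 < y" "y < e" "cumulant (- 1) + y < 0"
      using e \<open>cumulant (- 1) < 0\<close> by (auto simp: y_def)
    define a where "a = - (\<nu> / y) - 1"
    have a: "a < - 1" "0 < cumulant a - y * a"
      using y(1) \<nu>_pos left[OF y(1)] by (auto simp: a_def)
    obtain \<theta> where \<theta>: "a < \<theta>" "\<theta> < 0" "\<nu> * deriv ?g \<theta> - y = 0"
    proof (rule interior_critical_point[of a 0 "\<lambda>t. cumulant t - y * t" "\<lambda>\<theta>. \<nu> * deriv ?g \<theta> - y" 0 "- 1"])
      show "((\<lambda>t. cumulant t - y * t) has_real_derivative \<nu> * deriv ?g t - y) (at t)" if "t \<in> {a..0}" for t
        using that by (intro der_phi neg_D) auto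
    qed (use a y in auto)
    have \<theta>D: "\<theta> \<in> ?D" using neg_D \<theta>(2) by simp
    \<comment> \<open>At a negative exponent, replacing the positive slope \<open>y\<close> by x = 0
      only raises the linear term, so the cost stays within the rate at 0.\<close>
    have "\<theta> * y \<le> 0" using \<theta>(2) y(1) by (simp add: mult_nonpos_nonneg)
    then have "ereal (\<theta> * y - cumulant \<theta>) \<le> ereal (\<theta> * x - cumulant \<theta>)" using 2 by simp
    also have "\<dots> \<le> (SUP \<theta>\<in>?D. ereal (\<theta> * x - cumulant \<theta>))" by (rule SUP_upper[OF \<theta>D])
    finally show ?thesis
      using \<theta>D der_cum[OF \<theta>D] \<theta>(3) y 2 by (intro bexI[of _ \<theta>] exI[of _ y] conjI) auto
  next
    case 3
    obtain k where k: "(SUP \<theta>\<in>?D. ereal (\<theta> * x - cumulant \<theta>)) < ereal k"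
      using finite less_PInf_Ex_of_nat by auto
    \<comment> \<open>Solves \<open>\<theta> * x = \<bar>k\<bar>\<close> with \<theta> \<le> 0,
      where the cumulant is at most 0.\<close>
    define \<theta> where "\<theta> = - (\<bar>k\<bar> / (- x))"
    have \<theta>: "\<theta> \<le> 0" "\<theta> * x = \<bar>k\<bar>" using 3 by (auto simp: \<theta>_def divide_nonneg_neg)
    have "cumulant \<theta> \<le> 0" using cumulant_mono[OF \<theta>(1) exp_integrable_0] by simp
    then have "ereal k \<le> ereal (\<theta> * x - cumulant \<theta>)" using \<theta> by simp
    also have "\<dots> \<le> (SUP \<theta>\<in>?D. ereal (\<theta> * x - cumulant \<theta>))" by (rule SUP_upper[OF neg_D[OF \<theta>(1)]])
    finally show ?thesis using k by (simp add: not_le[symmetric])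
  qed
qed

text \<open>At a positive exponent an infinite total has infinite weight, so a finite expectation
  excludes it. This matters because \<open>cluster_process_count\<close> reports an infinite total
  as 0.\<close>

lemma total_finite:
  assumes \<theta>: "0 < \<theta>" and int: "tail_integrable \<theta>" "tail_integrable 0" and r: "0 < r"
  shows "AE \<omega> in M. total (ball 0 r) \<omega> \<noteq> \<top>"
proof -
  have int': "exp_integrable \<theta>" using int(1) by (simp add: tail_integrable_def)
  note [measurable] = measurable_total[of "ball 0 r", simplified]
  obtain w where "(\<integral>\<^sup>+c. overlap \<theta> (ball 0 r) c \<partial>Q) = ennreal w" "0 \<le> w"
    using overlap_limit[OF _ int] \<theta> r by auto
  then have "(\<integral>\<^sup>+\<omega>. exp_ennreal \<theta> (total (ball 0 r) \<omega>) \<partial>M) \<noteq> \<infinity>"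
    using \<theta> \<nu>_pos by (simp add: mgf_total_overlap int' flip: ennreal_mult)
  then have "AE \<omega> in M. exp_ennreal \<theta> (total (ball 0 r) \<omega>) \<noteq> \<infinity>"
    by (intro nn_integral_PInf_AE) measurable
  then show ?thesis
    by eventually_elim (use \<theta> in \<open>auto simp: exp_ennreal_def\<close>)
qed

text \<open>The auxiliary \<theta>0 > 0 serves negative \<theta>: there an infinite total has weight
  0 in \<open>exp_ennreal\<close> but weight 1 after \<open>enn2real\<close>, so almost sure
  finiteness must come from another exponent.\<close>

lemma count_mgf_limit:
  assumes \<theta>: "tail_integrable \<theta>" and \<theta>0: "0 < \<theta>0" "tail_integrable \<theta>0" and zero: "tail_integrable 0"
  shows "\<And>r. 0 < r \<Longrightarrow> integrable M (\<lambda>\<omega>. exp (\<theta> * cluster_process_count C (ball 0 r) \<omega>))"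
    and "((\<lambda>r. ln (\<integral>\<omega>. exp (\<theta> * cluster_process_count C (ball 0 r) \<omega>) \<partial>M) / ball_volume DIM('a) r) \<longlongrightarrow> cumulant \<theta>) at_top"
proof -
  let ?N = "\<lambda>r. cluster_process_count C (ball 0 r)"
  have "(\<forall>r>0. integrable M (\<lambda>\<omega>. exp (\<theta> * ?N r \<omega>))) \<and>
    ((\<lambda>r. ln (\<integral>\<omega>. exp (\<theta> * ?N r \<omega>) \<partial>M) / ball_volume DIM('a) r) \<longlongrightarrow> cumulant \<theta>) at_top"
  proof (cases "\<theta> = 0")
    case True
    then show ?thesis by (simp add: prob_space)
  next
    case False
    have int: "exp_integrable \<theta>" using \<theta> by (simp add: tail_integrable_def)
    obtain W where W: "((\<lambda>r. W r / (unit_ball_vol (real DIM('a)) * r ^ DIM('a))) \<longlongrightarrow> sgn \<theta> * (exp_moment \<theta> - 1)) at_top"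
        "\<And>r. 0 < r \<Longrightarrow> 0 \<le> W r \<and> (\<integral>\<^sup>+c. overlap \<theta> (ball 0 r) c \<partial>Q) = ennreal (W r)"
      using overlap_limit[OF False \<theta> zero] by blast
    have bochner: "has_bochner_integral M (\<lambda>\<omega>. exp (\<theta> * ?N r \<omega>)) (exp (sgn \<theta> * (\<nu> * W r)))" if r: "0 < r" for r
    proof (rule has_bochner_integral_nn_integral)
      show "(\<lambda>\<omega>. exp (\<theta> * ?N r \<omega>)) \<in> borel_measurable M"
        using measurable_cluster_process_count[of "ball 0 r"] by simp
      have "(\<integral>\<^sup>+\<omega>. ennreal (exp (\<theta> * ?N r \<omega>)) \<partial>M) = (\<integral>\<^sup>+\<omega>. exp_ennreal \<theta> (total (ball 0 r) \<omega>) \<partial>M)"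
      proof (rule nn_integral_cong_AE, use total_finite[OF \<theta>0 zero r] in eventually_elim)
        case (elim \<omega>)
        then show ?case
          by (simp only: exp_ennreal_def if_False) (simp add: cluster_process_count_def total_def)
      qed
      also have "\<dots> = exp_ennreal (sgn \<theta>) (ennreal (\<nu> * W r))"
        using W(2)[OF r] \<nu>_pos by (simp add: mgf_total_overlap[OF _ int False] ennreal_mult)
      also have "\<dots> = ennreal (exp (sgn \<theta> * (\<nu> * W r)))"
        using W(2)[OF r] \<nu>_pos by simp
      finally show "(\<integral>\<^sup>+\<omega>. ennreal (exp (\<theta> * ?N r \<omega>)) \<partial>M) = ennreal (exp (sgn \<theta> * (\<nu> * W r)))" .
    qed auto
    have "((\<lambda>r. sgn \<theta> * \<nu> * (W r / (unit_ball_vol (real DIM('a)) * r ^ DIM('a)))) \<longlongrightarrow>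
        sgn \<theta> * \<nu> * (sgn \<theta> * (exp_moment \<theta> - 1))) at_top"
      by (intro tendsto_intros W(1))
    \<comment> \<open>One sign comes from the outer exponential, the other from the limit of
      \<open>W\<close>; their product is 1.\<close>
    moreover have "sgn \<theta> * \<nu> * (sgn \<theta> * (exp_moment \<theta> - 1)) = cumulant \<theta>"
      using False by (simp add: cumulant_def sgn_if)
    moreover have "eventually (\<lambda>r. sgn \<theta> * \<nu> * (W r / (unit_ball_vol (real DIM('a)) * r ^ DIM('a))) =
        ln (\<integral>\<omega>. exp (\<theta> * ?N r \<omega>) \<partial>M) / ball_volume DIM('a) r) at_top"
      using eventually_gt_at_top[of 0]
    proof eventually_elim
      case (elim r)
      have "(\<integral>\<omega>. exp (\<theta> * ?N r \<omega>) \<partial>M) = exp (sgn \<theta> * (\<nu> * W r))"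
        by (rule has_bochner_integral_integral_eq[OF bochner[OF elim]])
      then show ?case by (simp only: ln_exp ball_volume_eq) simp
    qed
    ultimately show ?thesis
      using bochner by (auto intro: Lim_transform_eventually simp: has_bochner_integral_iff)
  qed
  then show "\<And>r. 0 < r \<Longrightarrow> integrable M (\<lambda>\<omega>. exp (\<theta> * ?N r \<omega>))"
    "((\<lambda>r. ln (\<integral>\<omega>. exp (\<theta> * ?N r \<omega>) \<partial>M) / ball_volume DIM('a) r) \<longlongrightarrow> cumulant \<theta>) at_top"
    by blast+
qed

lemma tail_integrableI:
  assumes "exp_integrable \<theta>"
    and "(\<integral>\<^sup>+c. ennreal (cluster_radius c ^ DIM('a) * exp (\<theta> * real (size c))) \<partial>Q) < \<infinity>"
  shows "tail_integrable \<theta>"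
proof -
  have "AE c in Q. 0 \<le> cluster_radius c ^ DIM('a) * exp (\<theta> * real (size c))"
    using AE_size_pos by eventually_elim (auto intro!: mult_nonneg_nonneg zero_le_power cluster_radius_nonneg)
  moreover have "(\<lambda>c. cluster_radius c ^ DIM('a) * exp (\<theta> * real (size c))) \<in> borel_measurable Q"
    by measurable
  ultimately show ?thesis
    using assms(2) unfolding tail_integrable_def by (intro conjI assms(1) integrableI_nonneg) auto
qed

theorem count_LDP:
  assumes mean: "(\<integral>\<^sup>+c. of_nat (size c) \<partial>Q) < \<infinity>"
    and smooth: "essentially_smooth (size_mgf Q)"
    and zero: "0 \<in> interior (size_mgf_domain Q)"
    and tail: "\<And>\<theta>. \<theta> \<in> interior (size_mgf_domain Q) \<Longrightarrow>
      (\<integral>\<^sup>+c. ennreal (cluster_radius c ^ DIM('a) * exp (\<theta> * real (size c))) \<partial>Q) < \<infinity>"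
  shows "satisfies_LDP M (\<lambda>r \<omega>. cluster_process_count C (ball 0 r) \<omega> / ball_volume DIM('a) r)
      (ball_volume DIM('a)) (legendre_transform (cluster_cumulant \<nu> Q))
    \<and> is_good (legendre_transform (cluster_cumulant \<nu> Q))"
proof -
  let ?D = "interior (size_mgf_domain Q)"
  let ?V = "\<lambda>r \<omega>. cluster_process_count C (ball 0 r) \<omega> / ball_volume DIM('a) r"
  have int: "exp_integrable \<theta>" if "\<theta> \<in> ?D" for \<theta>
    using that interior_subset size_mgf_domain_eq by blast
  have tails: "tail_integrable \<theta>" if "\<theta> \<in> ?D" for \<theta>
    by (rule tail_integrableI[OF int[OF that] tail[OF that]])
  obtain e where "0 < e" "ball 0 e \<subseteq> ?D"
    by (rule openE[OF open_interior zero])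
  \<comment> \<open>The positive exponent \<open>e / 2\<close> serves as the auxiliary \<theta>0 for
    finiteness of the counts.\<close>
  then have e: "0 < e / 2" "e / 2 \<in> ?D" by (auto simp: subset_iff dist_real_def)
  have vol: "0 < ball_volume DIM('a) r" if "0 < r" for r
    using that by (simp add: ball_volume_eq)
  have scaled: "ball_volume DIM('a) r * ?V r \<omega> = cluster_process_count C (ball 0 r) \<omega>" if "0 < r" for r \<omega>
    using vol[OF that] by simp
  interpret scaled_mgf_limit M ?V "ball_volume DIM('a)" ?D cumulant
  proof
    show "?V r \<in> borel_measurable M" if "0 < r" for r
      using measurable_cluster_process_count[of "ball 0 r"] by simp
    show "is_speed (ball_volume DIM('a))" by (rule is_speed_ball_volume) simp
    fix \<theta> assume \<theta>: "\<theta> \<in> ?D"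
    note lim = count_mgf_limit[OF tails[OF \<theta>] e(1) tails[OF e(2)] tails[OF zero]]
    show "integrable M (\<lambda>\<omega>. exp (\<theta> * (ball_volume DIM('a) r * ?V r \<omega>)))" if "0 < r" for r
      unfolding scaled[OF that] by (rule lim(1)[OF that])
    show "((\<lambda>r. ln (\<integral>\<omega>. exp (\<theta> * (ball_volume DIM('a) r * ?V r \<omega>)) \<partial>M) / ball_volume DIM('a) r) \<longlongrightarrow> cumulant \<theta>) at_top"
    proof (rule Lim_transform_eventually[OF lim(2)])
      show "eventually (\<lambda>r. ln (\<integral>\<omega>. exp (\<theta> * cluster_process_count C (ball 0 r) \<omega>) \<partial>M) / ball_volume DIM('a) r =
          ln (\<integral>\<omega>. exp (\<theta> * (ball_volume DIM('a) r * ?V r \<omega>)) \<partial>M) / ball_volume DIM('a) r) at_top"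
        using eventually_gt_at_top[of 0] by eventually_elim (simp only: scaled)
    qed
  qed (use zero in auto)
  have J: "legendre_transform (cluster_cumulant \<nu> Q) = J"
    by (rule ext) (simp only: legendre_interior J_def)
  have "satisfies_LDP M ?V (ball_volume DIM('a)) J"
  proof (rule LDP)
    show "\<theta> * (\<nu> * (\<integral>c. real (size c) \<partial>Q)) \<le> cumulant \<theta>" if "\<theta> \<in> ?D" for \<theta>
      by (rule cumulant_tangent_0[OF mean int[OF that]])
  qed (use exposed_points[OF smooth zero] in \<open>simp add: J_def\<close>)
  then show ?thesis using good_J by (simp only: J)
qed

end

theorem theorem5p1:
  fixes M :: "'w measure"
    and \<nu> :: real
    and Q :: "(real ^ 'd) multiset measure"
    and X :: "nat \<Rightarrow> 'w \<Rightarrow> real ^ 'd"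
    and C :: "nat \<Rightarrow> 'w \<Rightarrow> (real ^ 'd) multiset"
  assumes "0 < \<nu>"
    and "poisson_cluster_process M \<nu> Q X C"
    and "(\<integral>\<^sup>+C0. of_nat (size C0) \<partial>Q) < \<infinity>"
    and "essentially_smooth (size_mgf Q)"
    and "0 \<in> interior (size_mgf_domain Q)"
    and "\<And>\<theta>. \<theta> \<in> interior (size_mgf_domain Q) \<Longrightarrow>
           (\<integral>\<^sup>+C0. ennreal (cluster_radius C0 ^ CARD('d) * exp (\<theta> * real (size C0))) \<partial>Q) < \<infinity>"
  shows "satisfies_LDP M
           (\<lambda>r \<omega>. cluster_process_count C (ball 0 r) \<omega> / ball_volume CARD('d) r)
           (ball_volume CARD('d))
           (legendre_transform (cluster_cumulant \<nu> Q))
         \<and> is_good (legendre_transform (cluster_cumulant \<nu> Q))"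
proof -
  interpret poisson_cluster M \<nu> Q X C
    using assms(1,2) by unfold_locales
  show ?thesis
    using count_LDP[OF assms(3-5)] assms(6) by simp
qed

end
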